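(* Let $n\ge 1$ and let $D=(D_1,\ldots,D_n)$ be a diagram contained in $[n]^2$. The Schur character $\chi_D(\mathbf{x})=\chi_D(x_1,\ldots,x_n)$ is zero-one (every coefficient is $0$ or $1$), i.e. attains the lower bound $$\chi_D(\mathbf{x})=\sum_{\mathbf{x}^a\in\{\mathbf{x}^C:\ |C_j|=|D_j|\ \forall j\in[n]\}}\mathbf{x}^a$$ (the sum over the set of distinct monomials of the form $\mathbf{x}^C$), if and only if the valid part of $D$ satisfies one of the following conditions: (a) all boxes are in the same column; (b) all boxes are in the same row; (c) all empty grids lie in a single row.
   Context: Notation: $[n]=\{1,\ldots,n\}$. A diagram $D$ is a subset of the $n\times n$ grid $[n]^2$, identified with the list $D=(D_1,\ldots,D_n)$ of subsets of $[n]$, where $D_j=\{i: (i,j)\in D\}$ is the set of row indices of boxes in column $j$ (the square $(i,j)$ is in row $i$, column $j$). Squares in $D$ are called boxes; squares not in $D$ are called empty grids. For a diagram $C=(C_1,\ldots,C_n)$ put $\mathbf{x}^C=\prod_{j=1}^n\prod_{i\in C_j}x_i$. Valid part: the valid part of $D$ is obtained from $D$ by removing all empty columns ($D_j=\emptyset$) and all full columns ($D_j=[n]$), keeping all $n$ rows; its boxes and empty grids are the squares of the remaining columns that are in $D$, respectively not in $D$. Schur character: let $Y=(y_{i,j})_{1\le i,j\le n}$ be a matrix of indeterminates. For $C$ with $|C_j|=|D_j|$ for all $j$, let $Y_{D_j}^{C_j}$ be the submatrix of $Y$ with row set $C_j$ and column set $D_j$ (both in increasing order; the empty determinant is $1$).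 The Weyl module is $$\mathbb{W}_D=\mathrm{Span}_{\mathbb{C}}\Big\{\prod_{j=1}^n\det\big(Y_{D_j}^{C_j}\big)\ :\ C=(C_1,\ldots,C_n),\ C_j\subseteq[n],\ |C_j|=|D_j|\text{ for all }j\Big\}\subset\mathbb{C}[Y],$$ with $G=GL_n(\mathbb{C})$ acting by $f(Y)\cdot g=f(g^{-1}Y)$. For a $G$-module $N$, $\mathrm{char}(N)(x_1,\ldots,x_n)$ is the trace on $N$ of the diagonal matrix with entries $x_1,\ldots,x_n$, and the dual character is $\mathrm{char}^*(N)(x_1,\ldots,x_n)=\mathrm{char}(N)(x_1^{-1},\ldots,x_n^{-1})$. The Schur character is $\chi_D=\mathrm{char}^*(\mathbb{W}_D)$, a polynomial with nonnegative integer coefficients. *)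

theory Defs
  imports
    "HOL-Library.Poly_Mapping"
    "Jordan_Normal_Form.Determinant"
    "Jordan_Normal_Form.Gauss_Jordan_Elimination"
    "Jordan_Normal_Form.DL_Submatrix"
begin

text \<open>
  Rows, columns and variables are indexed by \<open>{..<n}\<close> instead of \<open>{1..n}\<close>, in accordance with the
  matrices of Jordan\_Normal\_Form.
\<close>

section \<open>Complex polynomials in variables of type \<open>'v\<close>\<close>

type_synonym 'v cpoly = "('v \<Rightarrow>\<^sub>0 nat) \<Rightarrow>\<^sub>0 complex"

definition Const :: "complex \<Rightarrow> 'v cpoly" where
  "Const c = Poly_Mapping.single 0 c"

definition Var :: "'v \<Rightarrow> 'v cpoly" where
  "Var v = Poly_Mapping.single (Poly_Mapping.single v 1) 1"

text \<open>
  The value of \<open>p\<close> at \<open>\<sigma>\<close>, with coefficients mapped by \<open>h\<close>. It is used with \<open>h = id\<close> (evaluation at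
  complex numbers) and with \<open>h = Const\<close> (substitution of polynomials for the variables).
\<close>
definition eval_poly_at :: "(complex \<Rightarrow> 'b::comm_semiring_1) \<Rightarrow> ('v \<Rightarrow> 'b) \<Rightarrow> 'v cpoly \<Rightarrow> 'b" where
  "eval_poly_at h \<sigma> p =
     (\<Sum>m\<in>Poly_Mapping.keys p. h (Poly_Mapping.lookup p m) *
        (\<Prod>v\<in>Poly_Mapping.keys m. \<sigma> v ^ Poly_Mapping.lookup m v))"

definition indets :: "'v cpoly \<Rightarrow> 'v set" where
  "indets p = (\<Union>m\<in>Poly_Mapping.keys p. Poly_Mapping.keys m)"

definition cpoly_scale :: "complex \<Rightarrow> 'v cpoly \<Rightarrow> 'v cpoly" where
  "cpoly_scale c p = Const c * p"

interpretation cpoly: vector_space "cpoly_scale :: complex \<Rightarrow> 'v cpoly \<Rightarrow> 'v cpoly"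
proof
  fix a b :: complex and p q :: "'v cpoly"
  show "cpoly_scale a (p + q) = cpoly_scale a p + cpoly_scale a q"
    by (simp add: cpoly_scale_def algebra_simps)
  show "cpoly_scale (a + b) p = cpoly_scale a p + cpoly_scale b p"
    by (simp add: cpoly_scale_def Const_def single_add algebra_simps)
  show "cpoly_scale a (cpoly_scale b p) = cpoly_scale (a * b) p"
    by (simp add: cpoly_scale_def Const_def mult_single flip: mult.assoc)
  show "cpoly_scale 1 p = p"
    by (simp add: cpoly_scale_def Const_def)
qed

text \<open>
  Trace of the restriction to \<open>N\<close> of a linear map \<open>T\<close> that preserves the finite-dimensional
  subspace \<open>N\<close>. It does not depend on the basis chosen.
\<close>
definition trace_on :: "'v cpoly set \<Rightarrow> ('v cpoly \<Rightarrow> 'v cpoly) \<Rightarrow> complex" where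
  "trace_on N T =
     (let B = (SOME B. cpoly.independent B \<and> cpoly.span B = N)
      in \<Sum>b\<in>B. cpoly.representation B (T b) b)"

section \<open>Diagrams\<close>

definition is_diagram :: "nat \<Rightarrow> (nat \<times> nat) set \<Rightarrow> bool" where
  "is_diagram n D \<longleftrightarrow> D \<subseteq> {..<n} \<times> {..<n}"

definition column :: "(nat \<times> nat) set \<Rightarrow> nat \<Rightarrow> nat set" where
  "column D j = {i. (i, j) \<in> D}"

definition same_column_sizes :: "nat \<Rightarrow> (nat \<times> nat) set \<Rightarrow> (nat \<times> nat) set set" where
  "same_column_sizes n D =
     {C. is_diagram n C \<and> (\<forall>j<n. card (column C j) = card (column D j))}"

definition diagram_monomial :: "nat \<Rightarrow> (nat \<times> nat) set \<Rightarrow> nat cpoly" where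
  "diagram_monomial n C = (\<Prod>j<n. \<Prod>i\<in>column C j. Var i)"

definition valid_columns :: "nat \<Rightarrow> (nat \<times> nat) set \<Rightarrow> nat set" where
  "valid_columns n D = {j. j < n \<and> column D j \<noteq> {} \<and> column D j \<noteq> {..<n}}"

definition valid_boxes :: "nat \<Rightarrow> (nat \<times> nat) set \<Rightarrow> (nat \<times> nat) set" where
  "valid_boxes n D = {(i, j). i < n \<and> j \<in> valid_columns n D \<and> (i, j) \<in> D}"

definition valid_empty_grids :: "nat \<Rightarrow> (nat \<times> nat) set \<Rightarrow> (nat \<times> nat) set" where
  "valid_empty_grids n D = {(i, j). i < n \<and> j \<in> valid_columns n D \<and> (i, j) \<notin> D}"

section \<open>Weyl modules and Schur characters\<close>

definition Y_mat :: "nat \<Rightarrow> (nat \<times> nat) cpoly mat" where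
  "Y_mat n = mat n n Var"

definition weyl_generator :: "nat \<Rightarrow> (nat \<times> nat) set \<Rightarrow> (nat \<times> nat) set \<Rightarrow> (nat \<times> nat) cpoly" where
  "weyl_generator n D C = (\<Prod>j<n. det (submatrix (Y_mat n) (column C j) (column D j)))"

definition weyl_module :: "nat \<Rightarrow> (nat \<times> nat) set \<Rightarrow> (nat \<times> nat) cpoly set" where
  "weyl_module n D = cpoly.span (weyl_generator n D ` same_column_sizes n D)"

text \<open>
  The action \<open>f(Y) \<cdot> g = f(g\<^sup>-\<^sup>1 Y)\<close> of an invertible \<open>n \<times> n\<close> matrix \<open>g\<close>; for
  other \<open>g\<close> the value is irrelevant.
\<close>
definition gl_act :: "nat \<Rightarrow> complex mat \<Rightarrow> (nat \<times> nat) cpoly \<Rightarrow> (nat \<times> nat) cpoly" where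
  "gl_act n g f =
     eval_poly_at Const (\<lambda>(i, j). (map_mat Const (the (mat_inverse g)) * Y_mat n) $$ (i, j)) f"

text \<open>
  Characters as functions on the torus; only arguments with \<open>x i \<noteq> 0\<close> for all \<open>i < n\<close> are
  meaningful.
\<close>
definition character :: "nat \<Rightarrow> (nat \<times> nat) cpoly set \<Rightarrow> (nat \<Rightarrow> complex) \<Rightarrow> complex" where
  "character n N x = trace_on N (gl_act n (mat_diag n x))"

definition dual_character :: "nat \<Rightarrow> (nat \<times> nat) cpoly set \<Rightarrow> (nat \<Rightarrow> complex) \<Rightarrow> complex" where
  "dual_character n N x = character n N (\<lambda>i. inverse (x i))"

text \<open>
  The dual character of the Weyl module, as a polynomial in the variables \<open>x i\<close> with \<open>i < n\<close>.
  A polynomial is determined by its values on the torus. One with the required values exists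
  because the diagonal matrix \<open>diag(x\<^sup>-\<^sup>1)\<close> multiplies the generator of \<open>C\<close> by the value at \<open>x\<close>
  of the monomial of \<open>C\<close>.
\<close>
definition schur_character :: "nat \<Rightarrow> (nat \<times> nat) set \<Rightarrow> nat cpoly" where
  "schur_character n D =
     (THE p. indets p \<subseteq> {..<n} \<and>
        (\<forall>x. (\<forall>i<n. x i \<noteq> 0) \<longrightarrow>
           eval_poly_at id x p = dual_character n (weyl_module n D) x))"

definition zero_one :: "'v cpoly \<Rightarrow> bool" where
  "zero_one p \<longleftrightarrow> (\<forall>m. Poly_Mapping.lookup p m \<in> {0, 1})"

end

theory Submission
  imports
    Defs
    "HOL-Library.Product_Lexorder" (* a linear order on the indices of Y makes the polynomials an idom *)
    "HOL-Computational_Algebra.Primes"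
begin

text \<open>
  The generators of the Weyl module are weight vectors, so the coefficient of a monomial in the
  Schur character is the dimension of the span of the generators of that weight, which is positive.
  Hence the character is zero-one iff any two generators of equal weight are proportional, and this
  is also when it attains the lower bound. If a single column is valid, the weight determines the
  diagram; if all valid columns are the same singleton or the same complement of a singleton, the
  weight determines the multiset of minors in the product. Otherwise two valid columns can be
  chosen that are different, or equal of size between \<open>2\<close> and \<open>n - 2\<close>. Since all
  other factors cancel, it suffices to move rows between these two columns in such a way that the
  products of two minors are not proportional; a specialization of \<open>Y\<close> killing just one of the
  products shows this.
\<close>

section \<open>Evaluation of polynomials\<close>

text \<open>The inner product of \<open>eval_poly_at\<close> under a name of its own: it turns sums
  of exponents into products, and on the torus it is the character of the weight
  \<open>m\<close>.\<close>

definition monomial_value :: "('v \<Rightarrow> 'b::comm_semiring_1) \<Rightarrow> ('v \<Rightarrow>\<^sub>0 nat) \<Rightarrow> 'b" where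
  "monomial_value \<sigma> m = (\<Prod>v\<in>Poly_Mapping.keys m. \<sigma> v ^ Poly_Mapping.lookup m v)"

lemma monomial_value_superset:
  assumes "finite A" "Poly_Mapping.keys m \<subseteq> A"
  shows "monomial_value \<sigma> m = (\<Prod>v\<in>A. \<sigma> v ^ Poly_Mapping.lookup m v)"
  unfolding monomial_value_def using assms
  by (intro prod.mono_neutral_left) (auto simp: in_keys_iff)

lemma monomial_value_zero [simp]: "monomial_value \<sigma> 0 = 1"
  by (simp add: monomial_value_def)

lemma monomial_value_single [simp]:
  "monomial_value \<sigma> (Poly_Mapping.single v k) = \<sigma> v ^ k"
  by (simp add: monomial_value_def)

lemma monomial_value_add:
  "monomial_value \<sigma> (m + m') = monomial_value \<sigma> m * monomial_value \<sigma> m'"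
proof -
  let ?A = "Poly_Mapping.keys m \<union> Poly_Mapping.keys m'"
  have "Poly_Mapping.keys (m + m') \<subseteq> ?A"
    by (rule Poly_Mapping.keys_add)
  then show ?thesis
    by (simp add: monomial_value_superset[of ?A] lookup_add power_add prod.distrib)
qed

lemma monomial_value_sum:
  "monomial_value \<sigma> (\<Sum>i\<in>I. f i) = (\<Prod>i\<in>I. monomial_value \<sigma> (f i))"
  by (induction I rule: infinite_finite_induct) (auto simp: monomial_value_add)

text \<open>Terms outside the support vanish because \<open>h\<close> maps zero to zero. A common
  finite index set allows several polynomials to be evaluated together.\<close>

lemma eval_poly_at_superset:
  assumes "comm_ring_hom h" "finite A" "Poly_Mapping.keys p \<subseteq> A"
  shows "eval_poly_at h \<sigma> p = (\<Sum>m\<in>A. h (Poly_Mapping.lookup p m) * monomial_value \<sigma> m)"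
proof -
  interpret comm_ring_hom h by fact
  show ?thesis
    unfolding eval_poly_at_def monomial_value_def using assms(2,3)
    by (intro sum.mono_neutral_left) (auto simp: in_keys_iff)
qed

lemma cpoly_sum_singles:
  fixes p :: "'v cpoly"
  shows "p = (\<Sum>m\<in>Poly_Mapping.keys p. Poly_Mapping.single m (Poly_Mapping.lookup p m))"
  by (rule poly_mapping_eqI)
    (auto simp: lookup_sum lookup_single when_def in_keys_iff sum.delta')

text \<open>Additivity follows by summing over the union of the supports. Multiplicativity is then
  checked on single terms only, since every polynomial is the sum of its terms.\<close>

lemma eval_poly_at_comm_ring_hom:
  fixes h :: "complex \<Rightarrow> 'b::comm_ring_1" and \<sigma> :: "'v \<Rightarrow> 'b"
  assumes "comm_ring_hom h"
  shows "comm_ring_hom (eval_poly_at h \<sigma>)"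
proof -
  interpret comm_ring_hom h by fact
  let ?e = "eval_poly_at h \<sigma>"
  note superset = eval_poly_at_superset[OF assms]
  have single: "?e (Poly_Mapping.single m c) = h c * monomial_value \<sigma> m" for m c
    by (subst superset[of "{m}"]) auto
  have add: "?e (p + q) = ?e p + ?e q" for p q
  proof -
    let ?A = "Poly_Mapping.keys p \<union> Poly_Mapping.keys q"
    have "Poly_Mapping.keys (p + q) \<subseteq> ?A"
      by (rule Poly_Mapping.keys_add)
    then show ?thesis
      by (simp add: superset[of ?A] lookup_add hom_add algebra_simps sum.distrib)
  qed
  have zero: "?e 0 = 0"
    by (simp add: eval_poly_at_def)
  have sum: "?e (sum f I) = (\<Sum>i\<in>I. ?e (f i))" for f :: "'i \<Rightarrow> 'v cpoly" and I
    by (induction I rule: infinite_finite_induct) (auto simp: add zero)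
  have mult_single: "?e (Poly_Mapping.single m c * Poly_Mapping.single m' c')
      = ?e (Poly_Mapping.single m c) * ?e (Poly_Mapping.single m' c')" for m c m' c'
    by (simp add: mult_single single hom_mult monomial_value_add)
  have mult: "?e (p * q) = ?e p * ?e q" for p q
  proof -
    let ?s = "\<lambda>p m. Poly_Mapping.single m (Poly_Mapping.lookup p m)"
    have "?e (p * q) = ?e ((\<Sum>m\<in>Poly_Mapping.keys p. ?s p m) * (\<Sum>m\<in>Poly_Mapping.keys q. ?s q m))"
      using cpoly_sum_singles[of p] cpoly_sum_singles[of q] by simp
    also have "\<dots> = ?e (\<Sum>m\<in>Poly_Mapping.keys p. ?s p m) * ?e (\<Sum>m\<in>Poly_Mapping.keys q. ?s q m)"
      by (simp add: sum_product sum mult_single)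
    finally show ?thesis
      using cpoly_sum_singles[of p] cpoly_sum_singles[of q] by simp
  qed
  have "?e 1 = 1"
    using single[of 0 1] by simp
  with add zero mult show ?thesis
    by unfold_locales auto
qed

lemma eval_poly_at_single:
  assumes "comm_ring_hom h"
  shows "eval_poly_at h \<sigma> (Poly_Mapping.single m c) = h c * monomial_value \<sigma> m"
proof -
  interpret comm_ring_hom h by fact
  show ?thesis
    by (subst eval_poly_at_superset[OF assms, of "{m}"]) auto
qed

lemma eval_poly_at_Var:
  assumes "comm_ring_hom h"
  shows "eval_poly_at h \<sigma> (Var v) = \<sigma> v"
proof -
  interpret comm_ring_hom h by fact
  show ?thesis
    by (simp add: Var_def eval_poly_at_single[OF assms])
qed

lemma comm_ring_hom_Const: "comm_ring_hom Const"
  by unfold_locales (auto simp: Const_def single_add mult_single)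

lemma comm_ring_hom_id: "comm_ring_hom id"
  by unfold_locales auto

section \<open>Separation of monomials and polynomials by points of the torus\<close>

text \<open>With pairwise distinct primes as coordinates, unique factorization recovers the
  exponents from the value of a monomial.\<close>

lemma primes_separate_monomials:
  obtains x :: "nat \<Rightarrow> complex"
  where "\<And>i. x i \<noteq> 0"
    and "inj (monomial_value x)"
proof -
  obtain f :: "nat \<Rightarrow> nat" where f: "inj f" "range f \<subseteq> {p. prime p}"
    using infinite_countable_subset[OF primes_infinite] by blast
  have pr: "prime (f i)" for i
    using f by auto
  have inj: "inj (monomial_value f)"
  proof (rule injI)
    fix m m' :: "nat \<Rightarrow>\<^sub>0 nat"
    assume eq: "monomial_value f m = monomial_value f m'"
    let ?A = "Poly_Mapping.keys m \<union> Poly_Mapping.keys m'"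
    show "m = m'"
    proof (rule poly_mapping_eqI)
      fix i
      \<comment> \<open>Adding \<open>i\<close> puts \<open>f i\<close> among the bases even when
        its exponent is \<open>0\<close>, so that the multiplicity of \<open>f i\<close> is always
        the exponent of \<open>i\<close>.\<close>
      let ?B = "insert i ?A"
      have mult: "multiplicity (f i) (monomial_value f m'') = Poly_Mapping.lookup m'' i"
        if "Poly_Mapping.keys m'' \<subseteq> ?B" for m''
      proof -
        have "monomial_value f m'' = (\<Prod>v\<in>?B. f v ^ Poly_Mapping.lookup m'' v)"
          using that by (intro monomial_value_superset) auto
        also have "\<dots> = (\<Prod>p\<in>f ` ?B. p ^ Poly_Mapping.lookup m'' (the_inv f p))"
          using f(1) by (subst prod.reindex) (auto simp: inj_on_def the_inv_f_f)
        finally have "multiplicity (f i) (monomial_value f m'')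
            = (if f i \<in> f ` ?B then Poly_Mapping.lookup m'' (the_inv f (f i)) else 0)"
          using pr by (simp only:) (rule multiplicity_prod_prime_powers, auto)
        then show ?thesis
          using f(1) by (simp add: the_inv_f_f)
      qed
      have "Poly_Mapping.lookup m i = multiplicity (f i) (monomial_value f m)"
        by (rule mult[symmetric]) auto
      also have "\<dots> = Poly_Mapping.lookup m' i"
        unfolding eq by (rule mult) auto
      finally show "Poly_Mapping.lookup m i = Poly_Mapping.lookup m' i" .
    qed
  qed
  have "monomial_value (\<lambda>i. of_nat (f i)) m = (of_nat (monomial_value f m) :: complex)" for m
    by (simp add: monomial_value_def)
  then have "inj (monomial_value (\<lambda>i. of_nat (f i) :: complex))"
    using inj by (simp add: inj_on_def)
  moreover have "of_nat (f i) \<noteq> (0 :: complex)" for i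
    using prime_gt_0_nat[OF pr[of i]] by simp
  ultimately show thesis
    by (rule that[rotated])
qed

text \<open>A Vandermonde argument: the relation extends from powers to all polynomials
  \<open>q\<close>, and the polynomial \<open>?q\<close> vanishes at every node except
  \<open>N a\<close>.\<close>

lemma power_sums_zero_imp_coeffs_zero:
  fixes c N :: "'a \<Rightarrow> complex"
  assumes "finite A" "inj_on N A" "\<And>k. (\<Sum>a\<in>A. c a * N a ^ k) = 0" "a \<in> A"
  shows "c a = 0"
proof -
  have poly: "(\<Sum>a\<in>A. c a * poly q (N a)) = 0" for q
  proof -
    have "(\<Sum>a\<in>A. c a * poly q (N a)) = (\<Sum>i\<le>degree q. coeff q i * (\<Sum>a\<in>A. c a * N a ^ i))"
      unfolding poly_altdef sum_distrib_left
      by (subst sum.swap) (simp add: algebra_simps)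
    then show ?thesis
      using assms(3) by simp
  qed
  let ?q = "\<Prod>b\<in>A - {a}. [:- N b, 1:]"
  have "0 = (\<Sum>b\<in>A. c b * poly ?q (N b))"
    using poly by simp
  also have "\<dots> = (\<Sum>b\<in>A. if b = a then c a * poly ?q (N a) else 0)"
    using assms(1) by (intro sum.cong) (auto simp: poly_prod)
  also have "\<dots> = c a * poly ?q (N a)"
    using assms(1,4) by simp
  finally have "c a * poly ?q (N a) = 0"
    by simp
  moreover have "poly ?q (N a) \<noteq> 0"
    using assms by (auto simp: poly_prod inj_on_def)
  ultimately show ?thesis
    by simp
qed

lemma monomial_value_power:
  fixes x :: "'v \<Rightarrow> 'b::comm_semiring_1"
  shows "monomial_value (\<lambda>i. x i ^ k) m = monomial_value x m ^ k"
  by (simp add: monomial_value_def prod_power_distrib flip: power_mult) (simp add: mult.commute)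

text \<open>The coordinatewise powers of one separating point suffice: at the \<open>k\<close>-th
  power, a polynomial becomes a combination of \<open>k\<close>-th powers of distinct numbers. This
  gives the uniqueness needed for \<open>THE\<close> in \<open>schur_character\<close>.\<close>

lemma cpoly_eq_if_eq_on_torus:
  fixes p q :: "nat cpoly"
  assumes "\<And>x. (\<And>i. x i \<noteq> 0) \<Longrightarrow> eval_poly_at id x p = eval_poly_at id x q"
  shows "p = q"
proof (rule poly_mapping_eqI)
  fix m
  obtain x :: "nat \<Rightarrow> complex" where x: "\<And>i. x i \<noteq> 0" "inj (monomial_value x)"
    using primes_separate_monomials by blast
  let ?A = "insert m (Poly_Mapping.keys p \<union> Poly_Mapping.keys q)"
  have "Poly_Mapping.lookup p m - Poly_Mapping.lookup q m = 0"
  proof (rule power_sums_zero_imp_coeffs_zero[of ?A "monomial_value x"])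
    fix k
    have "eval_poly_at id (\<lambda>i. x i ^ k) p = eval_poly_at id (\<lambda>i. x i ^ k) q"
      by (rule assms) (simp add: x)
    then show "(\<Sum>m\<in>?A. (Poly_Mapping.lookup p m - Poly_Mapping.lookup q m) * monomial_value x m ^ k) = 0"
      by (subst (asm) (1 2) eval_poly_at_superset[OF comm_ring_hom_id, of ?A])
        (auto simp: monomial_value_power left_diff_distrib sum_subtractf simp del: sum.insert_if)
  qed (use x in \<open>auto simp: inj_on_def\<close>)
  then show "Poly_Mapping.lookup p m = Poly_Mapping.lookup q m"
    by simp
qed

section \<open>Traces\<close>

context vector_space
begin

text \<open>An instance of tr(XY) = tr(YX), where one factor holds the coordinates of
  \<open>B\<close> in terms of \<open>B'\<close> and the other those of \<open>T b'\<close> in terms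
  of \<open>B\<close>. The lemma makes the choice by \<open>SOME\<close> in \<open>trace_on\<close>
  harmless.\<close>

lemma trace_basis_independent:
  assumes B: "independent B" "finite B" and B': "independent B'" "finite B'"
    and span: "span B = span B'" and T: "module_hom scale scale T" and inv: "\<And>v. v \<in> span B \<Longrightarrow> T v \<in> span B"
  shows "(\<Sum>b\<in>B. representation B (T b) b) = (\<Sum>b\<in>B'. representation B' (T b) b)"
proof -
  interpret T: module_hom scale scale T by fact
  have expand: "v = (\<Sum>b\<in>C. scale (representation C v b) b)"
    if "independent C" "finite C" "v \<in> span C" for C v
    using sum_representation_eq[OF that(1,3,2)] by simp
  have rep_sum: "representation C (\<Sum>i\<in>I. scale (r i) (w i)) c = (\<Sum>i\<in>I. r i * representation C (w i) c)"
    if "independent C" "\<And>i. i \<in> I \<Longrightarrow> w i \<in> span C" for C c r I and w :: "'b \<Rightarrow> 'b"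
    using that by (simp add: representation_sum representation_scale span_scale)
  have "(\<Sum>b\<in>B. representation B (T b) b)
      = (\<Sum>b\<in>B. representation B (T (\<Sum>b'\<in>B'. scale (representation B' b b') b')) b)"
    using expand[OF B'] span span_base[of _ B] by (intro sum.cong) auto
  also have "\<dots> = (\<Sum>b\<in>B. \<Sum>b'\<in>B'. representation B' b b' * representation B (T b') b)"
    using B(1) inv span span_base[of _ B'] by (simp add: T.sum T.scale rep_sum)
  also have "\<dots> = (\<Sum>b'\<in>B'. \<Sum>b\<in>B. representation B (T b') b * representation B' b b')"
    by (subst sum.swap) (simp add: mult.commute)
  also have "\<dots> = (\<Sum>b'\<in>B'. representation B' (\<Sum>b\<in>B. scale (representation B (T b') b) b) b')"
    using B'(1) span span_base[of _ B] by (simp add: rep_sum)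
  also have "\<dots> = (\<Sum>b\<in>B'. representation B' (T b) b)"
    using expand[OF B] span inv span_base[of _ B'] by (intro sum.cong) auto
  finally show ?thesis .
qed

end

section \<open>Minors\<close>

text \<open>The entries come from an arbitrary function, so that specializing the indeterminates
  just changes \<open>\<sigma>\<close>; \<open>pick\<close> enumerates a set in increasing
  order.\<close>

definition minor :: "(nat \<times> nat \<Rightarrow> 'b::comm_ring_1) \<Rightarrow> nat set \<Rightarrow> nat set \<Rightarrow> 'b" where
  "minor \<sigma> C A = det (mat (card C) (card A) (\<lambda>(i, j). \<sigma> (pick C i, pick A j)))"

lemma bij_betw_pick:
  assumes "finite C"
  shows "bij_betw (pick C) {..<card C} C"
proof -
  have inj: "inj_on (pick C) {..<card C}"
    by (rule linorder_inj_onI) (auto dest: pick_mono[rotated])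
  moreover have "pick C ` {..<card C} \<subseteq> C"
    using pick_in_set by auto
  ultimately have "pick C ` {..<card C} = C"
    using assms by (intro card_subset_eq) (auto simp: card_image)
  with inj show ?thesis
    by (simp add: bij_betw_def)
qed

lemma obtain_pick:
  assumes "finite C" "r \<in> C"
  obtains k where "k < card C" "pick C k = r"
  using bij_betw_pick[OF assms(1)] assms(2) by (metis bij_betw_iff_bijections lessThan_iff)

lemma pick_in: "i < card C \<Longrightarrow> pick C i \<in> C"
  by (simp add: pick_in_set)

lemma minor_Leibniz:
  assumes "card C = card A"
  shows "minor \<sigma> C A = (\<Sum>p | p permutes {0..<card A}.
     signof p * (\<Prod>i = 0..<card A. \<sigma> (pick C i, pick A (p i))))"
proof -
  have "minor \<sigma> C A = (\<Sum>p | p permutes {0..<card A}.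
     signof p * (\<Prod>i = 0..<card A. mat (card C) (card A) (\<lambda>(i, j). \<sigma> (pick C i, pick A j)) $$ (i, p i)))"
    unfolding minor_def by (rule det_def') (simp add: assms)
  also have "\<dots> = (\<Sum>p | p permutes {0..<card A}.
     signof p * (\<Prod>i = 0..<card A. \<sigma> (pick C i, pick A (p i))))"
  proof (intro sum.cong prod.cong refl arg_cong2[where f = "(*)"])
    fix p i
    assume "p \<in> {p. p permutes {0..<card A}}" "i \<in> {0..<card A}"
    then have "p i < card A"
      using permutes_in_image[of p "{0..<card A}" i] by auto
    with \<open>i \<in> _\<close> show "mat (card C) (card A) (\<lambda>(i, j). \<sigma> (pick C i, pick A j)) $$ (i, p i)
        = \<sigma> (pick C i, pick A (p i))"
      using assms by simp
  qed
  finally show ?thesis .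
qed

lemma minor_cong:
  assumes "\<And>i j. i \<in> C \<Longrightarrow> j \<in> A \<Longrightarrow> \<sigma> (i, j) = \<tau> (i, j)"
  shows "minor \<sigma> C A = minor \<tau> C A"
  unfolding minor_def by (intro arg_cong[where f = det] eq_matI) (auto simp: assms pick_in)

lemma hom_minor:
  assumes "comm_ring_hom h"
  shows "h (minor \<sigma> C A) = minor (\<lambda>v. h (\<sigma> v)) C A"
proof -
  interpret comm_ring_hom h by fact
  show ?thesis
    unfolding minor_def hom_det[symmetric]
    by (intro arg_cong[where f = det] eq_matI) auto
qed

text \<open>Every term of the Leibniz expansion uses each row exactly once and so collects the same
  factors. This is what makes the generators weight vectors.\<close>

lemma minor_scale_rows:
  assumes "finite C" "card C = card A"
  shows "minor (\<lambda>(i, j). x i * \<sigma> (i, j)) C A = (\<Prod>i\<in>C. x i) * minor \<sigma> C A"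
proof -
  have "(\<Prod>i = 0..<card A. x (pick C i)) = (\<Prod>i\<in>C. x i)"
    using prod.reindex_bij_betw[OF bij_betw_pick[OF assms(1)], of x] assms(2)
    by (simp add: atLeast0LessThan)
  then show ?thesis
    by (simp add: minor_Leibniz[OF assms(2)] prod.distrib sum_distrib_left algebra_simps)
qed

text \<open>Every Leibniz term passes through column \<open>q\<close>, in the row that the inverse
  permutation assigns to it, and hence has a zero factor.\<close>

lemma minor_zero_column:
  assumes "finite A" "card C = card A" "q \<in> A" "\<And>i. i \<in> C \<Longrightarrow> \<sigma> (i, q) = 0"
  shows "minor \<sigma> C A = 0"
  unfolding minor_Leibniz[OF assms(2)]
proof (intro sum.neutral ballI)
  fix p
  assume "p \<in> {p. p permutes {0..<card A}}"
  then have p: "p permutes {0..<card A}"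
    by simp
  obtain k where k: "k < card A" "pick A k = q"
    using obtain_pick[OF assms(1,3)] .
  have "inv_into UNIV p k < card A" "p (inv_into UNIV p k) = k"
    using permutes_in_image[OF permutes_inv[OF p], of k] k permutes_inverses[OF p] by auto
  then have "(\<Prod>i = 0..<card A. \<sigma> (pick C i, pick A (p i))) = 0"
    using k assms by (intro prod_zero bexI[of _ "inv_into UNIV p k"]) (auto simp: pick_in)
  then show "signof p * (\<Prod>i = 0..<card A. \<sigma> (pick C i, pick A (p i))) = 0"
    by simp
qed

lemma minor_equal_rows:
  assumes "finite C" "card C = card A" "r \<in> C" "s \<in> C" "r \<noteq> s"
    and "\<And>j. j \<in> A \<Longrightarrow> \<sigma> (r, j) = \<sigma> (s, j)"
  shows "minor \<sigma> C A = 0"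
proof -
  obtain k l where kl: "k < card C" "l < card C" "pick C k = r" "pick C l = s"
    using obtain_pick[OF assms(1,3)] obtain_pick[OF assms(1,4)] by metis
  show ?thesis
    unfolding minor_def
  proof (rule det_identical_rows[of _ "card A" k l])
    show "k \<noteq> l"
      using kl assms by auto
  qed (use kl assms in \<open>auto intro!: eq_vecI simp: pick_in\<close>)
qed

text \<open>A permutation matrix is inverted by its transpose.\<close>
lemma minor_permutation_nonzero:
  fixes \<sigma> :: "nat \<times> nat \<Rightarrow> 'b::idom"
  assumes "finite C" "bij_betw f C A"
    and \<sigma>: "\<And>i j. i \<in> C \<Longrightarrow> j \<in> A \<Longrightarrow> \<sigma> (i, j) = of_bool (f i = j)"
  shows "minor \<sigma> C A \<noteq> 0"
proof -
  have card: "card C = card A" and fin: "finite A"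
    using assms by (auto simp: bij_betw_same_card bij_betw_finite)
  define M where "M = mat (card C) (card A) (\<lambda>(i, j). \<sigma> (pick C i, pick A j))"
  have M: "M \<in> carrier_mat (card A) (card A)"
    by (simp add: M_def card)
  have "M * transpose_mat M = 1\<^sub>m (card A)"
  proof (rule eq_matI)
    fix i k
    assume "i < dim_row (1\<^sub>m (card A))" "k < dim_col (1\<^sub>m (card A))"
    then have ik: "i < card C" "k < card C"
      by (simp_all add: card)
    have fA: "f (pick C i) \<in> A" "f (pick C k) \<in> A"
      using ik assms(2) by (auto simp: pick_in bij_betw_def)
    have inj: "f (pick C i) = f (pick C k) \<longleftrightarrow> i = k"
      using ik assms(2) bij_betw_pick[OF assms(1)]
      by (auto simp: bij_betw_def inj_on_def pick_in)
    have "(M * transpose_mat M) $$ (i, k)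
        = (\<Sum>j\<in>{..<card A}. of_bool (f (pick C i) = pick A j) * of_bool (f (pick C k) = pick A j))"
      using ik by (auto simp: M_def card scalar_prod_def atLeast0LessThan \<sigma> pick_in intro!: sum.cong)
    also have "\<dots> = (\<Sum>j\<in>A. of_bool (f (pick C i) = j) * of_bool (f (pick C k) = j))"
      by (rule sum.reindex_bij_betw[OF bij_betw_pick[OF fin]])
    also have "\<dots> = (\<Sum>j\<in>A. if j = f (pick C i) then of_bool (f (pick C k) = f (pick C i)) else 0)"
      by (intro sum.cong) auto
    also have "\<dots> = of_bool (i = k)"
      using fA fin inj by auto
    finally show "(M * transpose_mat M) $$ (i, k) = 1\<^sub>m (card A) $$ (i, k)"
      using ik card by simp
  qed (use M in auto)
  then have "det M * det (transpose_mat M) = 1"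
    using det_mult[OF M, of "transpose_mat M"] M by simp
  then show ?thesis
    unfolding minor_def M_def[symmetric] by auto
qed

text \<open>The generic minor specializes to the determinant of a permutation matrix, given by any
  bijection from \<open>C\<close> to \<open>A\<close>.\<close>

lemma minor_Var_nonzero:
  assumes "finite C" "finite A" "card C = card A"
  shows "minor (Var :: nat \<times> nat \<Rightarrow> (nat \<times> nat) cpoly) C A \<noteq> 0"
proof
  assume zero: "minor (Var :: nat \<times> nat \<Rightarrow> (nat \<times> nat) cpoly) C A = 0"
  obtain f where f: "bij_betw f C A"
    using finite_same_card_bij[OF assms] by blast
  let ?e = "eval_poly_at id (\<lambda>(i, j). of_bool (f i = j) :: complex)"
  note hom = eval_poly_at_comm_ring_hom[OF comm_ring_hom_id]
  have "?e (minor Var C A) = minor (\<lambda>(i, j). of_bool (f i = j)) C A"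
    by (simp add: hom_minor[OF hom] eval_poly_at_Var[OF comm_ring_hom_id])
  moreover have "minor (\<lambda>(i, j). of_bool (f i = j) :: complex) C A \<noteq> 0"
    by (rule minor_permutation_nonzero[OF assms(1) f]) simp
  moreover have "?e 0 = 0"
    by (simp add: eval_poly_at_def)
  ultimately show False
    using zero by simp
qed

section \<open>Generators\<close>

lemma column_subset: "is_diagram n D \<Longrightarrow> column D j \<subseteq> {..<n}"
  by (auto simp: is_diagram_def column_def)

lemma finite_column: "is_diagram n D \<Longrightarrow> finite (column D j)"
  by (rule finite_subset[OF column_subset finite_lessThan])

lemma weyl_generator_minor:
  assumes "is_diagram n D" "C \<in> same_column_sizes n D"
  shows "weyl_generator n D C = (\<Prod>j<n. minor Var (column C j) (column D j))"
  unfolding weyl_generator_def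
proof (intro prod.cong refl)
  fix j
  have C: "is_diagram n C"
    using assms(2) by (simp add: same_column_sizes_def)
  \<comment> \<open>\<open>submatrix\<close> intersects the index sets with the range of the matrix;
    for diagrams this changes nothing.\<close>
  have *: "{i. i < n \<and> i \<in> column C j} = column C j" "{i. i < n \<and> i \<in> column D j} = column D j"
    using column_subset[OF C, of j] column_subset[OF assms(1), of j] by auto
  have "submatrix (Y_mat n) (column C j) (column D j)
    = mat (card (column C j)) (card (column D j)) (\<lambda>(i, k). Var (pick (column C j) i, pick (column D j) k))"
    using column_subset[OF C, of j] column_subset[OF assms(1), of j]
    by (auto simp: submatrix_def Y_mat_def * subset_iff pick_in intro!: eq_matI)
  then show "det (submatrix (Y_mat n) (column C j) (column D j)) = minor Var (column C j) (column D j)"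
    by (simp add: minor_def)
qed

lemma weyl_generator_nonzero:
  assumes "is_diagram n D" "C \<in> same_column_sizes n D"
  shows "weyl_generator n D C \<noteq> 0"
proof -
  have "is_diagram n C" "\<And>j. j < n \<Longrightarrow> card (column C j) = card (column D j)"
    using assms(2) by (auto simp: same_column_sizes_def)
  then show ?thesis
    unfolding weyl_generator_minor[OF assms]
    using minor_Var_nonzero finite_column assms(1) by fastforce
qed

section \<open>Weights of generators under the torus\<close>

text \<open>The exponent vector of \<open>diagram_monomial n C\<close>.\<close>

definition diagram_weight :: "nat \<Rightarrow> (nat \<times> nat) set \<Rightarrow> nat \<Rightarrow>\<^sub>0 nat" where
  "diagram_weight n C = (\<Sum>j<n. \<Sum>i\<in>column C j. Poly_Mapping.single i 1)"

lemma single_sum_one: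
  "Poly_Mapping.single (\<Sum>i\<in>I. f i) (1 :: complex) = (\<Prod>i\<in>I. Poly_Mapping.single (f i) 1)"
proof -
  have "Poly_Mapping.single (a + b) (1 :: complex) = Poly_Mapping.single a 1 * Poly_Mapping.single b 1"
    for a b :: "'a"
    by (simp add: mult_single)
  then show ?thesis
    by (induction I rule: infinite_finite_induct) auto
qed

lemma diagram_monomial_eq: "diagram_monomial n C = Poly_Mapping.single (diagram_weight n C) 1"
  by (simp add: diagram_monomial_def diagram_weight_def single_sum_one Var_def)

lemma lookup_diagram_weight:
  assumes "is_diagram n C"
  shows "Poly_Mapping.lookup (diagram_weight n C) i = card {j. j < n \<and> i \<in> column C j}"
proof -
  have "Poly_Mapping.lookup (diagram_weight n C) i = (\<Sum>j<n. of_bool (i \<in> column C j))"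
    unfolding diagram_weight_def lookup_sum
    using finite_column[OF assms]
    by (intro sum.cong) (auto simp: lookup_single when_def sum.delta')
  also have "\<dots> = card ({..<n} \<inter> {j. i \<in> column C j})"
    by (subst sum_of_bool_eq) auto
  also have "{..<n} \<inter> {j. i \<in> column C j} = {j. j < n \<and> i \<in> column C j}"
    by auto
  finally show ?thesis .
qed

lemma keys_diagram_weight:
  assumes "is_diagram n C"
  shows "Poly_Mapping.keys (diagram_weight n C) \<subseteq> {..<n}"
  using column_subset[OF assms]
  by (fastforce simp: in_keys_iff lookup_diagram_weight[OF assms] card_gt_0_iff)

text \<open>Invertibility excludes the result \<open>None\<close>, and uniqueness of inverses
  identifies the matrix returned.\<close>

lemma mat_inverse_mat_diag:
  fixes x :: "nat \<Rightarrow> complex"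
  assumes "\<And>i. i < n \<Longrightarrow> x i \<noteq> 0"
  shows "mat_inverse (mat_diag n (\<lambda>i. inverse (x i))) = Some (mat_diag n x)"
proof -
  let ?A = "mat_diag n (\<lambda>i. inverse (x i))" and ?B = "mat_diag n x"
  have AB: "?A * ?B = 1\<^sub>m n" "?B * ?A = 1\<^sub>m n"
    unfolding mat_diag_diag using assms by (auto simp: mat_diag_def intro!: eq_matI)
  have A: "?A \<in> carrier_mat n n" and B: "?B \<in> carrier_mat n n"
    by auto
  have "?A \<in> Units (ring_mat TYPE(complex) n ())"
    using AB A B by (auto simp: Units_def ring_mat_simps simp del: mat_diag_diag intro!: bexI[of _ ?B])
  then obtain B' where B': "mat_inverse ?A = Some B'"
    using mat_inverse(1)[OF A, where b = "()"] by (cases "mat_inverse ?A") auto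
  have "B' = ?B * ?A * B'"
    unfolding AB using mat_inverse(2)[OF A B'] left_mult_one_mat[of B' n n] by simp
  also have "\<dots> = ?B"
    using mat_inverse(2)[OF A B'] assoc_mult_mat[OF B A, of B' n] B by (simp del: mat_diag_diag)
  finally show ?thesis
    using B' by simp
qed

text \<open>The inverse in the dual character cancels the one in the action, so row \<open>i\<close>
  of \<open>Y\<close> is multiplied by \<open>x i\<close>, and each minor by the product over its
  rows.\<close>

lemma gl_act_weyl_generator:
  assumes "is_diagram n D" "C \<in> same_column_sizes n D" and x: "\<And>i. i < n \<Longrightarrow> x i \<noteq> 0"
  shows "gl_act n (mat_diag n (\<lambda>i. inverse (x i))) (weyl_generator n D C)
    = cpoly_scale (monomial_value x (diagram_weight n C)) (weyl_generator n D C)"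
proof -
  have C: "is_diagram n C" and card: "\<And>j. j < n \<Longrightarrow> card (column C j) = card (column D j)"
    using assms(2) by (auto simp: same_column_sizes_def)
  interpret Const: comm_ring_hom Const
    by (rule comm_ring_hom_Const)
  let ?\<sigma> = "\<lambda>(i, j). (map_mat Const (mat_diag n x) * Y_mat n) $$ (i, j)"
  have diag: "map_mat Const (mat_diag n x) = mat_diag n (\<lambda>i. Const (x i))"
    by (auto simp: mat_diag_def intro!: eq_matI)
  have \<sigma>: "?\<sigma> (i, j) = Const (x i) * Var (i, j)" if "i < n" "j < n" for i j
    using that by (simp add: diag mat_diag_mult_left[of _ n n] Y_mat_def)
  note hom = eval_poly_at_comm_ring_hom[OF comm_ring_hom_Const]
  interpret e: comm_ring_hom "eval_poly_at Const ?\<sigma>"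
    by (rule hom)
  have minor: "eval_poly_at Const ?\<sigma> (minor Var (column C j) (column D j))
      = Const (\<Prod>i\<in>column C j. x i) * minor Var (column C j) (column D j)" if "j < n" for j
  proof -
    have "eval_poly_at Const ?\<sigma> (minor Var (column C j) (column D j))
      = minor ?\<sigma> (column C j) (column D j)"
      by (simp add: hom_minor[OF hom] eval_poly_at_Var[OF comm_ring_hom_Const])
    also have "\<dots> = minor (\<lambda>(i, j). Const (x i) * Var (i, j)) (column C j) (column D j)"
    proof (rule minor_cong)
      fix i k
      assume "i \<in> column C j" "k \<in> column D j"
      then have "i < n" "k < n"
        using column_subset[OF C, of j] column_subset[OF assms(1), of j] by auto
      then show "?\<sigma> (i, k) = (\<lambda>(i, j). Const (x i) * Var (i, j)) (i, k)"
        using \<sigma> by simp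
    qed
    also have "\<dots> = (\<Prod>i\<in>column C j. Const (x i)) * minor Var (column C j) (column D j)"
      by (rule minor_scale_rows) (auto simp: card that finite_column[OF C])
    finally show ?thesis
      by (simp add: Const.hom_prod)
  qed
  have "gl_act n (mat_diag n (\<lambda>i. inverse (x i))) (weyl_generator n D C)
    = eval_poly_at Const ?\<sigma> (\<Prod>j<n. minor Var (column C j) (column D j))"
    using mat_inverse_mat_diag[of n x] x
    by (simp add: gl_act_def weyl_generator_minor[OF assms(1,2)])
  also have "\<dots> = (\<Prod>j<n. Const (\<Prod>i\<in>column C j. x i)) * (\<Prod>j<n. minor Var (column C j) (column D j))"
    unfolding e.hom_prod prod.distrib[symmetric] by (rule prod.cong[OF refl], rule minor) simp
  also have "(\<Prod>j<n. Const (\<Prod>i\<in>column C j. x i)) = Const (monomial_value x (diagram_weight n C))"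
    by (simp add: Const.hom_prod diagram_weight_def monomial_value_sum)
  finally show ?thesis
    by (simp add: weyl_generator_minor[OF assms(1,2)] cpoly_scale_def)
qed

lemma module_hom_gl_act: "module_hom cpoly_scale cpoly_scale (gl_act n g)"
proof -
  let ?\<sigma> = "\<lambda>(i, j). (map_mat Const (the (mat_inverse g)) * Y_mat n) $$ (i, j)"
  interpret e: comm_ring_hom "eval_poly_at Const ?\<sigma>"
    by (rule eval_poly_at_comm_ring_hom[OF comm_ring_hom_Const])
  have "eval_poly_at Const ?\<sigma> (Const c) = Const c" for c
    unfolding Const_def[of c] eval_poly_at_single[OF comm_ring_hom_Const] by (simp add: Const_def)
  note const = this
  show ?thesis
    by unfold_locales (simp_all only: gl_act_def cpoly_scale_def e.hom_add e.hom_mult const)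
qed

text \<open>The basis chosen by \<open>SOME\<close> is finite, being independent inside the span of
  a finite set, so it may be exchanged for the eigenbasis.\<close>

lemma trace_on_eigenbasis:
  assumes "cpoly.independent B" "finite B" "module_hom cpoly_scale cpoly_scale T"
    and T: "\<And>b. b \<in> B \<Longrightarrow> T b = cpoly_scale (\<mu> b) b"
  shows "trace_on (cpoly.span B) T = (\<Sum>b\<in>B. \<mu> b)"
proof -
  define B' where "B' = (SOME B'. cpoly.independent B' \<and> cpoly.span B' = cpoly.span B)"
  have B': "cpoly.independent B'" "cpoly.span B' = cpoly.span B"
    using someI[of "\<lambda>B'. cpoly.independent B' \<and> cpoly.span B' = cpoly.span B" B] assms(1)
    by (auto simp: B'_def)
  have fin: "finite B'"
    using cpoly.independent_span_bound[OF assms(2) B'(1)] B'(2) cpoly.span_superset by blast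
  have inv: "T v \<in> cpoly.span B" if "v \<in> cpoly.span B" for v
  proof -
    have "T ` cpoly.span B \<subseteq> cpoly.span B"
      unfolding module_hom.span_image[OF assms(3), symmetric]
      by (rule cpoly.span_minimal) (auto simp: T intro: cpoly.span_scale cpoly.span_base)
    with that show ?thesis
      by blast
  qed
  have "trace_on (cpoly.span B) T = (\<Sum>b\<in>B. cpoly.representation B (T b) b)"
    unfolding trace_on_def B'_def[symmetric] Let_def
    using cpoly.trace_basis_independent[OF assms(1,2) B'(1) fin B'(2)[symmetric] assms(3) inv] by simp
  also have "\<dots> = (\<Sum>b\<in>B. \<mu> b)"
    using assms(1) by (intro sum.cong)
      (auto simp: T cpoly.representation_scale cpoly.span_base cpoly.representation_basis)
  finally show ?thesis .
qed

section \<open>Weight bases\<close>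

lemma finite_same_column_sizes: "finite (same_column_sizes n D)"
  by (rule finite_subset[of _ "Pow ({..<n} \<times> {..<n})"])
    (auto simp: same_column_sizes_def is_diagram_def)

text \<open>A basis of the Weyl module consisting of generators. It is indexed by diagrams so that
  each basis vector carries a weight; different diagrams may have the same generator, hence the
  injectivity on \<open>S\<close>.\<close>

locale weight_basis =
  fixes n :: nat and D :: "(nat \<times> nat) set" and S :: "(nat \<times> nat) set set"
  assumes D: "is_diagram n D"
    and S_subset: "S \<subseteq> same_column_sizes n D"
    and inj: "inj_on (weyl_generator n D) S"
    and indep: "cpoly.independent (weyl_generator n D ` S)"
    and span: "cpoly.span (weyl_generator n D ` S) = weyl_module n D"

text \<open>A maximal independent set of generators still spans; one diagram is selected for each of
  its elements.\<close>

lemma weight_basis_exists: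
  assumes "is_diagram n D"
  obtains S where "weight_basis n D S"
proof -
  let ?G = "weyl_generator n D ` same_column_sizes n D"
  obtain B where B: "B \<subseteq> ?G" "cpoly.independent B" "?G \<subseteq> cpoly.span B"
    using cpoly.maximal_independent_subset by blast
  obtain S where S: "S \<subseteq> same_column_sizes n D" "inj_on (weyl_generator n D) S"
      "B = weyl_generator n D ` S"
    using B(1) unfolding subset_image_inj by blast
  have "cpoly.span B = weyl_module n D"
    unfolding weyl_module_def using B cpoly.span_mono cpoly.span_minimal cpoly.subspace_span
    by (metis subset_antisym)
  with S B assms have "weight_basis n D S"
    by unfold_locales auto
  then show thesis
    by (rule that)
qed

context weight_basis
begin

abbreviation "gen \<equiv> weyl_generator n D"

lemma finite_S: "finite S"
  using finite_subset[OF S_subset finite_same_column_sizes] .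

lemma gen_in_span: "C \<in> same_column_sizes n D \<Longrightarrow> gen C \<in> cpoly.span (gen ` S)"
  unfolding span weyl_module_def by (intro cpoly.span_base imageI)

lemma dual_character_eq:
  assumes "\<And>i. i < n \<Longrightarrow> x i \<noteq> 0"
  shows "dual_character n (weyl_module n D) x = (\<Sum>C\<in>S. monomial_value x (diagram_weight n C))"
proof -
  \<comment> \<open>Eigenvalues are indexed by basis vectors here, so the diagram is recovered by
    inverting \<open>gen\<close> on \<open>S\<close>.\<close>
  let ?\<mu> = "\<lambda>b. monomial_value x (diagram_weight n (inv_into S gen b))"
  have "dual_character n (weyl_module n D) x = (\<Sum>b\<in>gen ` S. ?\<mu> b)"
    unfolding dual_character_def character_def span[symmetric]
  proof (rule trace_on_eigenbasis[OF indep _ module_hom_gl_act])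
    fix b
    assume "b \<in> gen ` S"
    then obtain C where C: "C \<in> S" "b = gen C"
      by auto
    then show "gl_act n (mat_diag n (\<lambda>i. inverse (x i))) b = cpoly_scale (?\<mu> b) b"
      using gl_act_weyl_generator[OF D _ assms, of C] S_subset inj by auto
  qed (simp add: finite_S)
  also have "\<dots> = (\<Sum>C\<in>S. monomial_value x (diagram_weight n C))"
    by (simp add: sum.reindex[OF inj] inj cong: sum.cong)
  finally show ?thesis .
qed

lemma lookup_sum_monomials:
  "Poly_Mapping.lookup (\<Sum>C\<in>S. diagram_monomial n C) m
    = of_nat (card {C \<in> S. diagram_weight n C = m})"
proof -
  have "Poly_Mapping.lookup (\<Sum>C\<in>S. diagram_monomial n C) m
      = (\<Sum>C\<in>S. of_bool (diagram_weight n C = m))"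
    unfolding lookup_sum
    by (intro sum.cong refl) (simp add: diagram_monomial_eq lookup_single when_def)
  also have "\<dots> = of_nat (card (S \<inter> {C. diagram_weight n C = m}))"
    by (rule sum_of_bool_eq[OF finite_S finite_S])
  also have "S \<inter> {C. diagram_weight n C = m} = {C \<in> S. diagram_weight n C = m}"
    by auto
  finally show ?thesis .
qed

text \<open>The sum takes the values of the dual character by \<open>dual_character_eq\<close>, and
  values on the torus determine a polynomial.\<close>

lemma schur_character_eq: "schur_character n D = (\<Sum>C\<in>S. diagram_monomial n C)"
  unfolding schur_character_def
proof (rule the_equality)
  interpret id: comm_ring_hom "eval_poly_at id x" for x :: "nat \<Rightarrow> complex"
    by (rule eval_poly_at_comm_ring_hom[OF comm_ring_hom_id])
  let ?p = "\<Sum>C\<in>S. diagram_monomial n C"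
  have eval: "eval_poly_at id x ?p = (\<Sum>C\<in>S. monomial_value x (diagram_weight n C))" for x
    by (simp add: id.hom_sum diagram_monomial_eq eval_poly_at_single[OF comm_ring_hom_id])
  have "indets ?p \<subseteq> {..<n}"
  proof
    fix i
    assume "i \<in> indets ?p"
    then obtain m where m: "Poly_Mapping.lookup ?p m \<noteq> 0" "i \<in> Poly_Mapping.keys m"
      by (auto simp: indets_def in_keys_iff)
    then have "{C \<in> S. diagram_weight n C = m} \<noteq> {}"
      unfolding lookup_sum_monomials by (metis card.empty of_nat_0)
    then obtain C where "C \<in> S" "diagram_weight n C = m"
      by auto
    moreover from this have "is_diagram n C"
      using S_subset by (auto simp: same_column_sizes_def)
    ultimately show "i \<in> {..<n}"
      using keys_diagram_weight[of n C] m(2) by auto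
  qed
  then show *: "indets ?p \<subseteq> {..<n} \<and>
        (\<forall>x. (\<forall>i<n. x i \<noteq> 0) \<longrightarrow> eval_poly_at id x ?p = dual_character n (weyl_module n D) x)"
    by (simp add: eval dual_character_eq)
  fix q
  assume "indets q \<subseteq> {..<n} \<and>
        (\<forall>x. (\<forall>i<n. x i \<noteq> 0) \<longrightarrow> eval_poly_at id x q = dual_character n (weyl_module n D) x)"
  with * show "q = ?p"
    by (intro cpoly_eq_if_eq_on_torus) simp
qed

text \<open>A generator is an eigenvector of the torus element given by pairwise distinct primes, whose
  eigenvalues determine the weights.\<close>
lemma gen_in_span_weight:
  assumes "C \<in> same_column_sizes n D"
  shows "gen C \<in> cpoly.span (gen ` {C' \<in> S. diagram_weight n C' = diagram_weight n C})"
proof -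
  obtain x :: "nat \<Rightarrow> complex" where x: "\<And>i. x i \<noteq> 0" "inj (monomial_value x)"
    by (rule primes_separate_monomials) (rule that)
  let ?T = "gl_act n (mat_diag n (\<lambda>i. inverse (x i)))"
  let ?\<mu> = "\<lambda>C. monomial_value x (diagram_weight n C)"
  interpret T: module_hom cpoly_scale cpoly_scale ?T
    by (rule module_hom_gl_act)
  have T: "?T (gen C') = cpoly_scale (?\<mu> C') (gen C')" if "C' \<in> same_column_sizes n D" for C'
    by (rule gl_act_weyl_generator[OF D that]) (rule x)
  define r where "r = (\<lambda>C'. cpoly.representation (gen ` S) (gen C) (gen C'))"
  have expand: "gen C = (\<Sum>C'\<in>S. cpoly_scale (r C') (gen C'))"
    using cpoly.sum_representation_eq[OF indep gen_in_span[OF assms], of "gen ` S"] finite_S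
    by (simp add: r_def sum.reindex[OF inj])
  \<comment> \<open>The map \<open>?T\<close> minus the scalar \<open>?\<mu> C\<close> kills
    \<open>gen C\<close>, while each coefficient of the expansion is multiplied by a difference of
    eigenvalues.\<close>
  have "(\<Sum>C'\<in>S. cpoly_scale (r C' * (?\<mu> C' - ?\<mu> C)) (gen C'))
      = ?T (\<Sum>C'\<in>S. cpoly_scale (r C') (gen C')) - cpoly_scale (?\<mu> C) (\<Sum>C'\<in>S. cpoly_scale (r C') (gen C'))"
    using S_subset by (auto simp: T.sum T.scale T cpoly.scale_sum_right right_diff_distrib
        cpoly.scale_left_diff_distrib sum_subtractf mult.commute intro!: sum.cong)
  also have "\<dots> = 0"
    using expand T[OF assms] by simp
  finally have "(\<Sum>b\<in>gen ` S. cpoly_scale (r (inv_into S gen b) * (?\<mu> (inv_into S gen b) - ?\<mu> C)) b) = 0"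
    by (simp add: sum.reindex[OF inj] inj cong: sum.cong)
  from cpoly.independentD[OF indep _ subset_refl this] finite_S
  have zero: "r C' * (?\<mu> C' - ?\<mu> C) = 0" if "C' \<in> S" for C'
    using that inj by fastforce
  have r: "r C' = 0" if "C' \<in> S" "diagram_weight n C' \<noteq> diagram_weight n C" for C'
    using zero[OF that(1)] that(2) x(2) by (auto simp: inj_def)
  have "gen C = (\<Sum>C' | C' \<in> S \<and> diagram_weight n C' = diagram_weight n C. cpoly_scale (r C') (gen C'))"
    by (subst expand, rule sum.mono_neutral_right) (auto simp: finite_S r)
  also have "\<dots> \<in> cpoly.span (gen ` {C' \<in> S. diagram_weight n C' = diagram_weight n C})"
    by (intro cpoly.span_sum cpoly.span_scale cpoly.span_base) auto
  finally show ?thesis .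
qed

text \<open>Otherwise the nonzero vector \<open>gen C\<close> would lie in the span of the empty
  set. Thus every monomial \<open>x^C\<close> occurs in the character.\<close>

lemma weight_nonempty:
  assumes "C \<in> same_column_sizes n D"
  shows "{C' \<in> S. diagram_weight n C' = diagram_weight n C} \<noteq> {}"
proof
  assume empty: "{C' \<in> S. diagram_weight n C' = diagram_weight n C} = {}"
  show False
    using gen_in_span_weight[OF assms] weyl_generator_nonzero[OF D assms] unfolding empty by simp
qed

section \<open>Criteria for a zero-one character\<close>

lemma zero_one_iff_card:
  "zero_one (schur_character n D) \<longleftrightarrow> (\<forall>m. card {C \<in> S. diagram_weight n C = m} \<le> 1)"
proof -
  have "of_nat k \<in> {0, 1 :: complex} \<longleftrightarrow> k \<le> 1" for k
    using of_nat_eq_iff[of k 1, where 'a = complex] by auto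
  then show ?thesis
    unfolding zero_one_def schur_character_eq lookup_sum_monomials by simp
qed

text \<open>If a weight has only one basis vector, all generators of that weight are multiples of
  it. Conversely, two distinct basis vectors of the same weight cannot be proportional. The
  resulting criterion no longer refers to \<open>S\<close>.\<close>

lemma zero_one_iff_proportional:
  "zero_one (schur_character n D) \<longleftrightarrow>
    (\<forall>C\<in>same_column_sizes n D. \<forall>C'\<in>same_column_sizes n D.
       diagram_weight n C = diagram_weight n C' \<longrightarrow> (\<exists>c. gen C' = cpoly_scale c (gen C)))"
  unfolding zero_one_iff_card
proof (intro iffI ballI impI allI)
  fix C C'
  assume card: "\<forall>m. card {C \<in> S. diagram_weight n C = m} \<le> 1"
    and C: "C \<in> same_column_sizes n D" and C': "C' \<in> same_column_sizes n D"
    and eq: "diagram_weight n C = diagram_weight n C'"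
  let ?W = "{C' \<in> S. diagram_weight n C' = diagram_weight n C}"
  have "finite ?W" "card ?W \<noteq> 0"
    using weight_nonempty[OF C] finite_S by auto
  then have "card ?W = 1"
    using card[rule_format, of "diagram_weight n C"] by linarith
  then obtain C0 where W: "?W = {C0}"
    by (rule card_1_singletonE)
  obtain a where a: "gen C = cpoly_scale a (gen C0)"
    using gen_in_span_weight[OF C] unfolding W by (auto simp: cpoly.span_singleton)
  obtain b where b: "gen C' = cpoly_scale b (gen C0)"
    using gen_in_span_weight[OF C'] unfolding eq[symmetric] W by (auto simp: cpoly.span_singleton)
  have "a \<noteq> 0"
    using a weyl_generator_nonzero[OF D C] by auto
  then have "gen C' = cpoly_scale (b / a) (gen C)"
    using a b by simp
  then show "\<exists>c. gen C' = cpoly_scale c (gen C)" ..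
next
  fix m
  assume proportional: "\<forall>C\<in>same_column_sizes n D. \<forall>C'\<in>same_column_sizes n D.
       diagram_weight n C = diagram_weight n C' \<longrightarrow> (\<exists>c. gen C' = cpoly_scale c (gen C))"
  show "card {C \<in> S. diagram_weight n C = m} \<le> 1"
  proof (rule ccontr)
    assume "\<not> ?thesis"
    then obtain C C' where CC': "C \<in> S" "C' \<in> S" "C \<noteq> C'"
        "diagram_weight n C = m" "diagram_weight n C' = m"
      using card_le_Suc0_iff_eq[of "{C \<in> S. diagram_weight n C = m}"] finite_S by auto
    then have "C \<in> same_column_sizes n D" "C' \<in> same_column_sizes n D"
      using S_subset by auto
    with proportional CC'(4,5) obtain c where c: "gen C' = cpoly_scale c (gen C)"
      by metis
    have "gen C \<in> gen ` S - {gen C'}"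
      using CC' inj by (auto dest: inj_onD)
    from cpoly.span_scale[OF cpoly.span_base[OF this], of c]
    have "gen C' \<in> cpoly.span (gen ` S - {gen C'})"
      unfolding c[symmetric] .
    then show False
      using indep CC'(2) by (auto simp: cpoly.dependent_def)
  qed
qed

text \<open>Both sides have the same support, and the lower bound has coefficient \<open>1\<close>
  there. Since the coefficients of the character are positive on the support, agreement means that
  none exceeds \<open>1\<close>.\<close>

lemma eq_lower_bound_iff:
  "schur_character n D = (\<Sum>m\<in>diagram_monomial n ` same_column_sizes n D. m)
    \<longleftrightarrow> zero_one (schur_character n D)"
proof -
  let ?W = "diagram_weight n ` same_column_sizes n D"
  have "inj_on (\<lambda>m. Poly_Mapping.single m (1 :: complex)) ?W"
    by (auto simp: inj_on_def) (metis lookup_single_eq lookup_single_not_eq zero_neq_one)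
  moreover have "diagram_monomial n ` same_column_sizes n D = (\<lambda>m. Poly_Mapping.single m 1) ` ?W"
    by (auto simp: diagram_monomial_eq image_image)
  ultimately have "(\<Sum>m\<in>diagram_monomial n ` same_column_sizes n D. m)
      = (\<Sum>m\<in>?W. Poly_Mapping.single m 1)"
    by (simp add: sum.reindex)
  then have rhs: "Poly_Mapping.lookup (\<Sum>m\<in>diagram_monomial n ` same_column_sizes n D. m) m
      = of_nat (of_bool (m \<in> ?W))" for m
    by (auto simp: lookup_sum lookup_single when_def finite_same_column_sizes)
  have card: "(card {C \<in> S. diagram_weight n C = m} = of_bool (m \<in> ?W)) \<longleftrightarrow>
      card {C \<in> S. diagram_weight n C = m} \<le> 1" for m
  proof (cases "m \<in> ?W")
    case True
    then have "card {C \<in> S. diagram_weight n C = m} \<noteq> 0"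
      using weight_nonempty finite_S by auto
    with True show ?thesis
      by auto
  next
    case False
    then have "{C \<in> S. diagram_weight n C = m} = {}"
      using S_subset by auto
    with False show ?thesis
      by (simp only: card.empty) simp
  qed
  show ?thesis
    unfolding poly_mapping_eq_iff[of "schur_character n D"] fun_eq_iff[of "Poly_Mapping.lookup (schur_character n D)"]
      rhs zero_one_iff_card
    by (simp only: schur_character_eq lookup_sum_monomials of_nat_eq_iff card)
qed

end

section \<open>Sufficiency\<close>

text \<open>The empty set and the full set are the only sets of rows of their sizes.\<close>

lemma column_eq_outside_valid:
  assumes "is_diagram n D" "C \<in> same_column_sizes n D" "j < n" "j \<notin> valid_columns n D"
  shows "column C j = column D j"
proof -
  have C: "is_diagram n C" "card (column C j) = card (column D j)"
    using assms(2,3) by (auto simp: same_column_sizes_def)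
  consider "column D j = {}" | "column D j = {..<n}"
    using assms(3,4) by (auto simp: valid_columns_def)
  then show ?thesis
  proof cases
    case 1
    then show ?thesis
      using C finite_column[OF C(1), of j] by simp
  next
    case 2
    then show ?thesis
      using C card_subset_eq[OF _ column_subset[OF C(1), of j]] by simp
  qed
qed

text \<open>Empty and full columns contribute equally to both weights, so their contribution
  cancels.\<close>

lemma card_valid_columns_eq:
  assumes D: "is_diagram n D" and C: "C \<in> same_column_sizes n D" "C' \<in> same_column_sizes n D"
    and eq: "diagram_weight n C = diagram_weight n C'"
  shows "card {j \<in> valid_columns n D. i \<in> column C j} = card {j \<in> valid_columns n D. i \<in> column C' j}"
proof -
  let ?V = "valid_columns n D"
  let ?E = "{j. j < n \<and> j \<notin> ?V \<and> i \<in> column D j}"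
  have V: "j < n" if "j \<in> ?V" for j
    using that by (simp add: valid_columns_def)
  have fin: "finite {j \<in> ?V. P j}" for P
    by (rule finite_subset[of _ "{..<n}"]) (auto dest: V)
  have "Poly_Mapping.lookup (diagram_weight n X) i = card {j \<in> ?V. i \<in> column X j} + card ?E"
    if X: "X \<in> same_column_sizes n D" for X
  proof -
    have "is_diagram n X"
      using X by (simp add: same_column_sizes_def)
    then have "Poly_Mapping.lookup (diagram_weight n X) i = card {j. j < n \<and> i \<in> column X j}"
      by (rule lookup_diagram_weight)
    also have "{j. j < n \<and> i \<in> column X j} = {j \<in> ?V. i \<in> column X j} \<union> ?E"
      using column_eq_outside_valid[OF D X] V by auto
    also have "card \<dots> = card {j \<in> ?V. i \<in> column X j} + card ?E"
      by (rule card_Un_disjoint) (auto simp: fin)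
    finally show ?thesis .
  qed
  from this[OF C(1)] this[OF C(2)] eq show ?thesis
    by simp
qed

lemma weyl_generator_eqI:
  assumes D: "is_diagram n D" and C: "C \<in> same_column_sizes n D" "C' \<in> same_column_sizes n D"
    and eq: "(\<Prod>j\<in>valid_columns n D. minor Var (column C j) (column D j) :: (nat \<times> nat) cpoly)
      = (\<Prod>j\<in>valid_columns n D. minor Var (column C' j) (column D j))"
  shows "weyl_generator n D C = weyl_generator n D C'"
proof -
  let ?V = "valid_columns n D"
  have "?V \<subseteq> {..<n}"
    by (auto simp: valid_columns_def)
  then have "weyl_generator n D X = (\<Prod>j\<in>{..<n} - ?V. minor Var (column D j) (column D j))
      * (\<Prod>j\<in>?V. minor Var (column X j) (column D j))"
    if "X \<in> same_column_sizes n D" for X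
    using column_eq_outside_valid[OF D that]
    by (simp add: weyl_generator_minor[OF D that] prod.subset_diff[of ?V "{..<n}"])
  with C eq show ?thesis
    by simp
qed

text \<open>Expresses a product of minors by how often each minor occurs, which is the information
  that the weight supplies.\<close>

lemma prod_group_powers:
  fixes F :: "'i \<Rightarrow> 'b::comm_monoid_mult"
  assumes "finite V" "finite I" "u ` V \<subseteq> I"
  shows "(\<Prod>j\<in>V. F (u j)) = (\<Prod>i\<in>I. F i ^ card {j \<in> V. u j = i})"
proof -
  have "(\<Prod>j\<in>V. F (u j)) = (\<Prod>i\<in>I. \<Prod>j | j \<in> V \<and> u j = i. F (u j))"
    by (rule prod.group[OF assms, symmetric])
  also have "\<dots> = (\<Prod>i\<in>I. F i ^ card {j \<in> V. u j = i})"
    by (intro prod.cong refl) simp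
  finally show ?thesis .
qed

lemma weyl_generator_eq_if_same_weight:
  assumes D: "is_diagram n D" and C: "C \<in> same_column_sizes n D" "C' \<in> same_column_sizes n D"
    and eq: "diagram_weight n C = diagram_weight n C'"
    and valid: "(\<exists>c<n. \<forall>(i, j)\<in>valid_boxes n D. j = c) \<or>
      (\<exists>r<n. \<forall>(i, j)\<in>valid_boxes n D. i = r) \<or>
      (\<exists>r<n. \<forall>(i, j)\<in>valid_empty_grids n D. i = r)"
  shows "weyl_generator n D C = weyl_generator n D C'"
proof (rule weyl_generator_eqI[OF D C])
  let ?V = "valid_columns n D"
  let ?m = "minor Var :: nat set \<Rightarrow> nat set \<Rightarrow> (nat \<times> nat) cpoly"
  have V: "finite ?V" "\<And>j. j \<in> ?V \<Longrightarrow> j < n"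
    by (auto simp: valid_columns_def)
  note count = card_valid_columns_eq[OF D C eq]
  have sub: "column X j \<subseteq> {..<n}" "card (column X j) = card (column D j)"
    if "X \<in> same_column_sizes n D" "j \<in> ?V" for X j
    using that column_subset[of n X j] V by (auto simp: same_column_sizes_def)
  consider (column) c where "\<And>i j. (i, j) \<in> valid_boxes n D \<Longrightarrow> j = c"
    | (row) r where "r < n" "\<And>i j. (i, j) \<in> valid_boxes n D \<Longrightarrow> i = r"
    | (empty_row) r where "r < n" "\<And>i j. (i, j) \<in> valid_empty_grids n D \<Longrightarrow> i = r"
    using valid by blast
  then show "(\<Prod>j\<in>?V. ?m (column C j) (column D j)) = (\<Prod>j\<in>?V. ?m (column C' j) (column D j))"
  proof cases
    case column
    \<comment> \<open>Every valid column contains a box, so at most one column is valid, and the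
      weight determines it.\<close>
    have "j = c" if j: "j \<in> ?V" for j
    proof -
      obtain i where "i \<in> column D j"
        using j by (auto simp: valid_columns_def)
      then have "(i, j) \<in> valid_boxes n D"
        using j column_subset[OF D, of j] by (auto simp: valid_boxes_def column_def)
      then show ?thesis
        by (rule column)
    qed
    then have "?V = {} \<or> ?V = {c}"
      by auto
    moreover have "column C c = column C' c" if "?V = {c}"
    proof (rule Set.set_eqI)
      fix i
      have "{j \<in> {c}. P j} = (if P c then {c} else {})" for P :: "nat \<Rightarrow> bool"
        by auto
      then show "i \<in> column C c \<longleftrightarrow> i \<in> column C' c"
        using count[of i] that by (auto split: if_splits)
    qed
    ultimately show ?thesis
      by auto
  next
    case row
    have D_eq: "column D j = {r}" if "j \<in> ?V" for j
    proof -
      have "column D j \<subseteq> {r}"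
        using that column_subset[OF D, of j] row(2) by (fastforce simp: valid_boxes_def column_def)
      moreover have "column D j \<noteq> {}"
        using that by (simp add: valid_columns_def)
      ultimately show ?thesis
        by blast
    qed
    \<comment> \<open>All valid columns of \<open>X\<close> are singletons, so the minor with row
      \<open>i\<close> occurs once for every valid column containing \<open>i\<close>.\<close>
    have "(\<Prod>j\<in>?V. ?m (column X j) (column D j)) = (\<Prod>i<n. ?m {i} {r} ^ card {j \<in> ?V. i \<in> column X j})"
      if X: "X \<in> same_column_sizes n D" for X
    proof -
      have "\<forall>j\<in>?V. \<exists>i<n. column X j = {i}"
        using sub[OF X] D_eq by (fastforce simp: card_1_singleton_iff)
      then obtain u where u: "\<And>j. j \<in> ?V \<Longrightarrow> u j < n" "\<And>j. j \<in> ?V \<Longrightarrow> column X j = {u j}"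
        by metis
      have "(\<Prod>j\<in>?V. ?m (column X j) (column D j)) = (\<Prod>j\<in>?V. ?m {u j} {r})"
        by (intro prod.cong refl) (simp add: u D_eq)
      also have "\<dots> = (\<Prod>i<n. ?m {i} {r} ^ card {j \<in> ?V. u j = i})"
        by (rule prod_group_powers) (use u V in auto)
      also have "\<dots> = (\<Prod>i<n. ?m {i} {r} ^ card {j \<in> ?V. i \<in> column X j})"
        by (intro prod.cong refl arg_cong2[where f = power] arg_cong[where f = card])
          (auto simp: u)
      finally show ?thesis .
    qed
    then show ?thesis
      using C count by simp
  next
    case empty_row
    let ?co = "\<lambda>i. {..<n} - {i}"
    have D_eq: "column D j = ?co r" if "j \<in> ?V" for j
    proof -
      have "?co r \<subseteq> column D j"
        using that empty_row(2) by (fastforce simp: valid_empty_grids_def column_def)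
      moreover have "column D j \<subseteq> {..<n}" "column D j \<noteq> {..<n}"
        using that column_subset[OF D] by (auto simp: valid_columns_def)
      ultimately show ?thesis
        by auto
    qed
    \<comment> \<open>All valid columns of \<open>X\<close> omit exactly one row, so the minor
      omitting row \<open>i\<close> occurs once for every valid column without
      \<open>i\<close>.\<close>
    have "(\<Prod>j\<in>?V. ?m (column X j) (column D j))
        = (\<Prod>i<n. ?m (?co i) (?co r) ^ (card ?V - card {j \<in> ?V. i \<in> column X j}))"
      if X: "X \<in> same_column_sizes n D" for X
    proof -
      have "\<forall>j\<in>?V. \<exists>i<n. column X j = ?co i"
      proof
        fix j
        assume j: "j \<in> ?V"
        have "card ({..<n} - column X j) = 1"
          using sub[OF X j] D_eq[OF j] empty_row(1) finite_subset[OF sub(1)[OF X j]]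
          by (simp add: card_Diff_subset)
        then obtain i where "{..<n} - column X j = {i}"
          by (rule card_1_singletonE)
        with sub(1)[OF X j] show "\<exists>i<n. column X j = ?co i"
          by (intro exI[of _ i]) auto
      qed
      then obtain u where u: "\<And>j. j \<in> ?V \<Longrightarrow> u j < n" "\<And>j. j \<in> ?V \<Longrightarrow> column X j = ?co (u j)"
        by metis
      have card: "card {j \<in> ?V. u j = i} = card ?V - card {j \<in> ?V. i \<in> column X j}" if "i < n" for i
      proof -
        have "{j \<in> ?V. u j = i} = ?V - {j \<in> ?V. i \<in> column X j}"
          using that by (auto simp: u)
        then show ?thesis
          using V(1) by (simp add: card_Diff_subset)
      qed
      have "(\<Prod>j\<in>?V. ?m (column X j) (column D j)) = (\<Prod>j\<in>?V. ?m (?co (u j)) (?co r))"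
        by (intro prod.cong refl) (simp add: u D_eq)
      also have "\<dots> = (\<Prod>i<n. ?m (?co i) (?co r) ^ card {j \<in> ?V. u j = i})"
        by (rule prod_group_powers) (use u V in auto)
      finally show ?thesis
        by (simp add: card)
    qed
    then show ?thesis
      using C count by simp
  qed
qed

section \<open>Necessity\<close>

text \<open>The share of a single column in \<open>diagram_weight\<close>, for comparing weights
  when only two columns change.\<close>

definition rows_weight :: "nat set \<Rightarrow> nat \<Rightarrow>\<^sub>0 nat" where
  "rows_weight P = (\<Sum>i\<in>P. Poly_Mapping.single i 1)"

lemma rows_weight_insert [simp]:
  "finite P \<Longrightarrow> i \<notin> P \<Longrightarrow> rows_weight (insert i P) = Poly_Mapping.single i 1 + rows_weight P"
  by (simp add: rows_weight_def)

definition replace_columns ::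
    "(nat \<times> nat) set \<Rightarrow> nat \<Rightarrow> nat \<Rightarrow> nat set \<Rightarrow> nat set \<Rightarrow> (nat \<times> nat) set" where
  "replace_columns D j k P Q =
     {(i, l). if l = j then i \<in> P else if l = k then i \<in> Q else (i, l) \<in> D}"

lemma column_replace_columns:
  "column (replace_columns D j k P Q) l = (if l = j then P else if l = k then Q else column D l)"
  by (auto simp: column_def replace_columns_def)

text \<open>The assumption is the criterion of \<open>zero_one_iff_proportional\<close>; the lemmas
  below derive the shape of the valid columns from it.\<close>

locale proportional_diagram =
  fixes n :: nat and D :: "(nat \<times> nat) set"
  assumes D: "is_diagram n D"
    and proportional: "\<And>C C'. C \<in> same_column_sizes n D \<Longrightarrow> C' \<in> same_column_sizes n D \<Longrightarrow>
      diagram_weight n C = diagram_weight n C' \<Longrightarrow>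
      \<exists>c. weyl_generator n D C' = cpoly_scale c (weyl_generator n D C)"
begin

text \<open>All other columns are kept as in \<open>D\<close>. Their common factor \<open>?G\<close>
  is nonzero and cancels because the polynomials form an integral domain.\<close>

lemma minors_proportional:
  assumes jk: "j < n" "k < n" "j \<noteq> k"
    and sub: "P \<subseteq> {..<n}" "Q \<subseteq> {..<n}" "P' \<subseteq> {..<n}" "Q' \<subseteq> {..<n}"
    and card: "card P = card (column D j)" "card P' = card (column D j)"
      "card Q = card (column D k)" "card Q' = card (column D k)"
    and weight: "rows_weight P + rows_weight Q = rows_weight P' + rows_weight Q'"
  obtains c where "minor Var P' (column D j) * minor Var Q' (column D k)
    = Const c * (minor Var P (column D j) * minor Var Q (column D k))"
proof -
  let ?R = "{..<n} - {j} - {k}"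
  let ?G = "\<Prod>l\<in>?R. minor Var (column D l) (column D l) :: (nat \<times> nat) cpoly"
  have split_sum: "(\<Sum>l<n. f l) = f j + (f k + (\<Sum>l\<in>?R. f l))" for f :: "nat \<Rightarrow> nat \<Rightarrow>\<^sub>0 nat"
    using jk by (simp add: sum.remove[of "{..<n}" j] sum.remove[of "{..<n} - {j}" k])
  have split_prod: "(\<Prod>l<n. f l) = f j * (f k * (\<Prod>l\<in>?R. f l))" for f :: "nat \<Rightarrow> (nat \<times> nat) cpoly"
    using jk by (simp add: prod.remove[of "{..<n}" j] prod.remove[of "{..<n} - {j}" k])
  have mem: "replace_columns D j k X Y \<in> same_column_sizes n D"
    if "X \<subseteq> {..<n}" "Y \<subseteq> {..<n}" "card X = card (column D j)" "card Y = card (column D k)" for X Y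
  proof -
    have "is_diagram n (replace_columns D j k X Y)"
      using that D jk by (auto simp: is_diagram_def replace_columns_def split: if_splits)
    then show ?thesis
      using that by (simp add: same_column_sizes_def column_replace_columns)
  qed
  have w: "diagram_weight n (replace_columns D j k X Y)
      = rows_weight X + rows_weight Y + (\<Sum>l\<in>?R. rows_weight (column D l))" for X Y
    using jk by (simp add: diagram_weight_def split_sum column_replace_columns add.assoc
        rows_weight_def)
  have g: "weyl_generator n D (replace_columns D j k X Y)
      = (minor Var X (column D j) * minor Var Y (column D k)) * ?G"
    if "X \<subseteq> {..<n}" "Y \<subseteq> {..<n}" "card X = card (column D j)" "card Y = card (column D k)" for X Y
    using jk by (simp add: weyl_generator_minor[OF D mem[OF that]] split_prod column_replace_columns mult.assoc)
  have "?G \<noteq> 0"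
    by (auto simp: minor_Var_nonzero finite_column[OF D])
  moreover obtain c where "weyl_generator n D (replace_columns D j k P' Q')
      = cpoly_scale c (weyl_generator n D (replace_columns D j k P Q))"
    using proportional[OF mem mem] sub card weight w by metis
  ultimately have "minor Var P' (column D j) * minor Var Q' (column D k)
    = Const c * (minor Var P (column D j) * minor Var Q (column D k))"
    using sub card by (simp add: g cpoly_scale_def flip: mult.assoc)
  then show thesis
    by (rule that)
qed

section \<open>Shape of the valid columns\<close>

lemma valid_column_card:
  assumes "j \<in> valid_columns n D"
  shows "j < n" "finite (column D j)" "card (column D j) > 0" "card (column D j) < n"
proof -
  have j: "j < n" "column D j \<noteq> {}" "column D j \<noteq> {..<n}"
    using assms by (auto simp: valid_columns_def)
  then have "column D j \<subset> {..<n}"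
    using column_subset[OF D, of j] by blast
  then show "j < n" "finite (column D j)" "card (column D j) > 0" "card (column D j) < n"
    using j finite_column[OF D, of j] psubset_card_mono[of "{..<n}" "column D j"] by (auto simp: card_gt_0_iff)
qed

text \<open>Exchanging a row between the two columns gives minors that are told apart by the
  variables of a column \<open>q\<close> occurring in only one of the two factors.\<close>
lemma valid_column_subset:
  assumes j: "j \<in> valid_columns n D" and k: "k \<in> valid_columns n D" and "j \<noteq> k"
  shows "column D j \<subseteq> column D k"
proof (rule ccontr)
  let ?A = "column D j" and ?B = "column D k"
  assume "\<not> ?A \<subseteq> ?B"
  then obtain q where q: "q \<in> ?A" "q \<notin> ?B"
    by auto
  note A = valid_column_card[OF j] and B = valid_column_card[OF k]
  \<comment> \<open>Rows \<open>0\<close> and \<open>1\<close> are reserved for the exchange. As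
    valid columns are not full, the other rows suffice to complete both row sets.\<close>
  have "card ?A - 1 \<le> card {2..<n}" "card ?B - 1 \<le> card {2..<n}"
    using A B by auto
  obtain P where P: "P \<subseteq> {2..<n}" "card P = card ?A - 1" "finite P"
    by (rule obtain_subset_with_card_n[OF \<open>card ?A - 1 \<le> card {2..<n}\<close>])
  obtain Q where Q: "Q \<subseteq> {2..<n}" "card Q = card ?B - 1" "finite Q"
    by (rule obtain_subset_with_card_n[OF \<open>card ?B - 1 \<le> card {2..<n}\<close>])
  have notin: "0 \<notin> P" "1 \<notin> P" "0 \<notin> Q" "1 \<notin> Q" "Suc 0 \<notin> P" "Suc 0 \<notin> Q"
    using P(1) Q(1) by auto
  have sub: "insert i P \<subseteq> {..<n}" "insert i Q \<subseteq> {..<n}" if "i < 2" for i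
    using P(1) Q(1) that A by auto
  have card: "card (insert i P) = card ?A" "card (insert i Q) = card ?B" if "i < 2" for i
  proof -
    have "i \<notin> P" "i \<notin> Q"
      using P(1) Q(1) that by auto
    then show "card (insert i P) = card ?A" "card (insert i Q) = card ?B"
      using P Q A B by auto
  qed
  obtain c where c: "minor Var (insert 1 P) ?A * minor Var (insert 0 Q) ?B
      = Const c * (minor Var (insert 0 P) ?A * minor Var (insert 1 Q) ?B)"
    by (rule minors_proportional[OF A(1) B(1) \<open>j \<noteq> k\<close>, of "insert 0 P" "insert 1 Q" "insert 1 P" "insert 0 Q"])
      (use sub card P Q notin A(3) B(3) in \<open>auto simp: ac_simps\<close>)
  \<comment> \<open>Clearing column \<open>q\<close> in the rows \<open>insert 0 P\<close> kills the
    first factor on the right. The factors for \<open>?B\<close> do not involve column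
    \<open>q\<close> and stay unchanged.\<close>
  define \<sigma> :: "nat \<times> nat \<Rightarrow> (nat \<times> nat) cpoly" where
    "\<sigma> = (\<lambda>(i, l). if l = q \<and> i \<in> insert 0 P then 0 else Var (i, l))"
  note hom_\<sigma> = eval_poly_at_comm_ring_hom[OF comm_ring_hom_Const, of \<sigma>]
  interpret e: comm_ring_hom "eval_poly_at Const \<sigma>"
    by (rule hom_\<sigma>)
  have e: "eval_poly_at Const \<sigma> (minor Var X Y) = minor \<sigma> X Y" for X Y
    by (simp add: hom_minor[OF hom_\<sigma>] eval_poly_at_Var[OF comm_ring_hom_Const])
  have "minor \<sigma> (insert 0 P) ?A = 0"
    by (rule minor_zero_column[of _ _ q]) (auto simp: A card q \<sigma>_def)
  then have zero: "minor \<sigma> (insert 1 P) ?A * minor \<sigma> (insert 0 Q) ?B = 0"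
    using arg_cong[OF c, of "eval_poly_at Const \<sigma>"] by (simp only: e.hom_mult e) simp
  have "minor \<sigma> (insert 0 Q) ?B = minor Var (insert 0 Q) ?B"
    using q by (intro minor_cong) (auto simp: \<sigma>_def)
  moreover have "minor Var (insert 0 Q) ?B \<noteq> (0 :: (nat \<times> nat) cpoly)"
    by (rule minor_Var_nonzero) (use Q B card in auto)
  moreover have "minor \<sigma> (insert 1 P) ?A \<noteq> 0"
  proof
    assume zero: "minor \<sigma> (insert 1 P) ?A = 0"
    have "card P = card (?A - {q})"
      using P A q by simp
    then obtain f where f: "bij_betw f P (?A - {q})"
      using finite_same_card_bij[OF P(3)] A by blast
    \<comment> \<open>Row \<open>1\<close> is the only row of \<open>insert 1 P\<close> in which
      \<open>\<sigma>\<close> keeps the entry of column \<open>q\<close>, so it has to be matched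
      with \<open>q\<close>.\<close>
    let ?g = "f(1 := q)"
    have img: "?g ` P = ?A - {q}"
      using f notin by (auto simp: bij_betw_def)
    then have "?g ` insert 1 P = ?A"
      using q by auto
    moreover from this have "inj_on ?g (insert 1 P)"
      using P card[of 1] by (intro eq_card_imp_inj_on) auto
    ultimately have g: "bij_betw ?g (insert 1 P) ?A"
      by (simp only: bij_betw_def)
    define \<tau> :: "nat \<times> nat \<Rightarrow> complex" where "\<tau> = (\<lambda>(i, l). of_bool (?g i = l))"
    note hom_\<tau> = eval_poly_at_comm_ring_hom[OF comm_ring_hom_id, of \<tau>]
    interpret t: comm_ring_hom "eval_poly_at id \<tau>"
      by (rule hom_\<tau>)
    have "eval_poly_at id \<tau> (minor \<sigma> (insert 1 P) ?A)
        = minor (\<lambda>v. eval_poly_at id \<tau> (\<sigma> v)) (insert 1 P) ?A"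
      by (rule hom_minor[OF hom_\<tau>])
    moreover have "minor (\<lambda>v. eval_poly_at id \<tau> (\<sigma> v)) (insert 1 P) ?A \<noteq> 0"
    proof (rule minor_permutation_nonzero[OF _ g])
      fix i l
      assume il: "i \<in> insert 1 P" "l \<in> ?A"
      have "?g i \<noteq> q" if "i \<in> insert 0 P"
      proof -
        from that il notin have "i \<in> P"
          by auto
        with img show ?thesis
          by blast
      qed
      moreover have "eval_poly_at id \<tau> (\<sigma> (i, l)) = (if l = q \<and> i \<in> insert 0 P then 0 else \<tau> (i, l))"
        by (auto simp: \<sigma>_def eval_poly_at_Var[OF comm_ring_hom_id])
      ultimately show "eval_poly_at id \<tau> (\<sigma> (i, l)) = of_bool (?g i = l)"
        by (auto simp: \<tau>_def simp del: fun_upd_apply)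
    qed (use P in auto)
    ultimately show False
      using zero by simp
  qed
  ultimately show False
    using zero by simp
qed

text \<open>With a matrix whose rows \<open>0\<close> and \<open>2\<close> agree, and whose rows \<open>1\<close> and \<open>3\<close> agree, the
  row pairs \<open>{0, 1}, {2, 3}\<close> give nonzero minors and \<open>{0, 2}, {1, 3}\<close> zero ones.\<close>
lemma valid_column_card_extreme:
  assumes j: "j \<in> valid_columns n D" and k: "k \<in> valid_columns n D" and "j \<noteq> k"
  shows "card (column D j) = 1 \<or> card (column D j) = n - 1"
proof (rule ccontr)
  let ?A = "column D j"
  assume not: "\<not> ?thesis"
  note A = valid_column_card[OF j]
  have card_ge: "card ?A \<ge> 2"
    using A(3) not by linarith
  have eq: "column D k = ?A"
    using valid_column_subset[OF j k] valid_column_subset[OF k j] \<open>j \<noteq> k\<close> by auto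
  \<comment> \<open>The size is at least \<open>2\<close> and at most \<open>n - 2\<close>, so rows
    \<open>0\<close> to \<open>3\<close> can be set aside, with enough rows left for a common part
    \<open>P\<close> of all four row sets.\<close>
  have "card ?A - 2 \<le> card {4..<n}"
    using A not by auto
  then obtain P where P: "P \<subseteq> {4..<n}" "card P = card ?A - 2" "finite P"
    by (rule obtain_subset_with_card_n)
  have notin: "i \<notin> P" if "i < 4" for i
    using P(1) that by auto
  have sub: "insert h (insert i P) \<subseteq> {..<n}" if "h < 4" "i < 4" for h i
    using that P(1) A not by auto
  have card: "card (insert h (insert i P)) = card ?A" if "h < 4" "i < 4" "h \<noteq> i" for h i
    using that P card_ge notin by simp
  obtain c where c: "minor Var (insert 0 (insert 1 P)) ?A * minor Var (insert 2 (insert 3 P)) ?A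
      = Const c * (minor Var (insert 0 (insert 2 P)) ?A * minor Var (insert 1 (insert 3 P)) ?A)"
    by (rule minors_proportional[OF A(1) valid_column_card(1)[OF k] \<open>j \<noteq> k\<close>,
          of "insert 0 (insert 2 P)" "insert 1 (insert 3 P)" "insert 0 (insert 1 P)" "insert 2 (insert 3 P)",
          unfolded eq])
      (use P(3) in \<open>auto simp: sub card notin ac_simps simp del: insert_subset card_insert_disjoint One_nat_def\<close>)
  have "\<not> card ?A \<le> Suc 0"
    using card_ge by simp
  then obtain a b where ab: "a \<in> ?A" "b \<in> ?A" "a \<noteq> b"
    unfolding card_le_Suc0_iff_eq[OF A(2)] by blast
  have "card P = card (?A - {a, b})"
    using P A ab by (simp add: card_Diff_subset)
  then obtain f where f: "bij_betw f P (?A - {a, b})"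
    using finite_same_card_bij[OF P(3)] A by blast
  \<comment> \<open>The values \<open>a\<close> and \<open>b\<close> are each taken twice among rows
    \<open>0\<close> to \<open>3\<close>; \<open>P\<close> with one row for \<open>a\<close> and one
    for \<open>b\<close> is mapped bijectively onto \<open>?A\<close>.\<close>
  define g where "g = f(0 := a, 1 := b, 2 := a, 3 := b)"
  have g_vals: "g 0 = a" "g 1 = b" "g 2 = a" "g 3 = b"
    by (auto simp: g_def)
  have "g ` P = f ` P"
    using notin by (intro image_cong refl) (auto simp: g_def)
  then have img: "g ` P = ?A - {a, b}"
    using f by (simp add: bij_betw_def)
  have g: "bij_betw g (insert h (insert i P)) ?A" if "h < 4" "i < 4" "{g h, g i} = {a, b}" for h i
  proof -
    have "h \<noteq> i"
      using that ab by auto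
    have "g ` insert h (insert i P) = ?A"
      using that(3) img ab by auto
    moreover from this have "inj_on g (insert h (insert i P))"
      using P(3) card[OF that(1,2) \<open>h \<noteq> i\<close>] by (intro eq_card_imp_inj_on) auto
    ultimately show ?thesis
      by (simp add: bij_betw_def)
  qed
  define \<tau> :: "nat \<times> nat \<Rightarrow> complex" where "\<tau> = (\<lambda>(i, l). of_bool (g i = l))"
  note hom_\<tau> = eval_poly_at_comm_ring_hom[OF comm_ring_hom_id, of \<tau>]
  interpret t: comm_ring_hom "eval_poly_at id \<tau>"
    by (rule hom_\<tau>)
  have t: "eval_poly_at id \<tau> (minor Var X Y) = minor \<tau> X Y" for X Y
    by (simp add: hom_minor[OF hom_\<tau>] eval_poly_at_Var[OF comm_ring_hom_id])
  have "minor \<tau> (insert 0 (insert 2 P)) ?A = 0"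
    by (rule minor_equal_rows[of _ _ 0 2]) (use P(3) in \<open>auto simp: card g_vals \<tau>_def\<close>)
  then have "minor \<tau> (insert 0 (insert 1 P)) ?A * minor \<tau> (insert 2 (insert 3 P)) ?A = 0"
    using arg_cong[OF c, of "eval_poly_at id \<tau>"] by (simp only: t.hom_mult t) simp
  moreover have "minor \<tau> (insert h (insert i P)) ?A \<noteq> 0" if "h < 4" "i < 4" "{g h, g i} = {a, b}" for h i
    by (rule minor_permutation_nonzero[OF _ g[OF that]]) (use P(3) in \<open>auto simp: \<tau>_def\<close>)
  from this[of 0 1] this[of 2 3]
  have "minor \<tau> (insert 0 (insert 1 P)) ?A \<noteq> 0" "minor \<tau> (insert 2 (insert 3 P)) ?A \<noteq> 0"
    using g_vals by auto
  ultimately show False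
    by simp
qed

text \<open>Two or more valid columns are all equal, by inclusion both ways, and have
  \<open>1\<close> or \<open>n - 1\<close> boxes: this is a single row of boxes or of empty grids.
  With at most one valid column, all boxes share a column.\<close>

lemma valid_condition:
  assumes "n \<ge> 1"
  shows "(\<exists>c<n. \<forall>(i, j)\<in>valid_boxes n D. j = c) \<or>
      (\<exists>r<n. \<forall>(i, j)\<in>valid_boxes n D. i = r) \<or>
      (\<exists>r<n. \<forall>(i, j)\<in>valid_empty_grids n D. i = r)"
proof (cases "\<exists>j\<in>valid_columns n D. \<exists>k\<in>valid_columns n D. j \<noteq> k")
  case False
  have "\<exists>c<n. \<forall>j\<in>valid_columns n D. j = c"
  proof (cases "valid_columns n D = {}")
    case True
    with assms show ?thesis
      \<comment> \<open>Without valid columns any column index serves as witness;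
        \<open>n \<ge> 1\<close> makes \<open>0\<close> one.\<close>
      by (intro exI[of _ 0]) auto
  next
    case nonempty: False
    then obtain c where "c \<in> valid_columns n D"
      by auto
    with False show ?thesis
      by (intro exI[of _ c]) (auto simp: valid_columns_def)
  qed
  then show ?thesis
    by (auto simp: valid_boxes_def)
next
  case True
  then obtain j k where jk: "j \<in> valid_columns n D" "k \<in> valid_columns n D" "j \<noteq> k"
    by auto
  let ?A = "column D j"
  have eq: "column D l = ?A" if "l \<in> valid_columns n D" for l
    using valid_column_subset[OF that jk(1)] valid_column_subset[OF jk(1) that] by (cases "l = j") auto
  have box: "(i, l) \<in> D \<longleftrightarrow> i \<in> ?A" if "l \<in> valid_columns n D" for i l
    using eq[OF that] by (auto simp: column_def)
  from valid_column_card_extreme[OF jk] show ?thesis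
  proof
    assume "card ?A = 1"
    then obtain r where r: "?A = {r}"
      by (rule card_1_singletonE)
    then have "r < n"
      using column_subset[OF D, of j] by auto
    with r box show ?thesis
      by (auto simp: valid_boxes_def)
  next
    assume "card ?A = n - 1"
    then have "card ({..<n} - ?A) = 1"
      using assms column_subset[OF D, of j] finite_column[OF D, of j] by (simp add: card_Diff_subset)
    then obtain r where r: "{..<n} - ?A = {r}"
      by (rule card_1_singletonE)
    then have "\<exists>r<n. \<forall>(i, j)\<in>valid_empty_grids n D. i = r"
      using box by (intro exI[of _ r]) (auto simp: valid_empty_grids_def)
    then show ?thesis
      by blast
  qed
qed

end

theorem theorem1p1:
  fixes n :: nat and D :: "(nat \<times> nat) set"
  assumes "n \<ge> 1" and "is_diagram n D"
  defines "valid_condition \<equiv>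
      (\<exists>c<n. \<forall>(i, j)\<in>valid_boxes n D. j = c) \<or>
      (\<exists>r<n. \<forall>(i, j)\<in>valid_boxes n D. i = r) \<or>
      (\<exists>r<n. \<forall>(i, j)\<in>valid_empty_grids n D. i = r)"
  shows "(zero_one (schur_character n D) \<longleftrightarrow> valid_condition) \<and>
    (schur_character n D = (\<Sum>m\<in>diagram_monomial n ` same_column_sizes n D. m)
       \<longleftrightarrow> valid_condition)"
proof -
  obtain S where "weight_basis n D S"
    using weight_basis_exists[OF assms(2)] .
  then interpret weight_basis n D S .
  have "zero_one (schur_character n D) \<longleftrightarrow> valid_condition"
  proof
    assume "zero_one (schur_character n D)"
    then interpret proportional_diagram n D
      by unfold_locales (use assms(2) zero_one_iff_proportional in blast)+
    show valid_condition
      unfolding valid_condition_def using assms(1) by (rule valid_condition)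
  next
    assume valid: valid_condition
    show "zero_one (schur_character n D)"
      unfolding zero_one_iff_proportional
    \<comment> \<open>Under the condition, generators of equal weight are even equal, so the factor
      is \<open>1\<close>.\<close>
    proof (intro ballI impI exI[of _ 1])
      fix C C'
      assume C: "C \<in> same_column_sizes n D" "C' \<in> same_column_sizes n D"
        "diagram_weight n C = diagram_weight n C'"
      show "gen C' = cpoly_scale 1 (gen C)"
        unfolding cpoly.scale_one
        by (rule weyl_generator_eq_if_same_weight[OF assms(2) C valid[unfolded valid_condition_def], symmetric])
    qed
  qed
  then show ?thesis
    unfolding eq_lower_bound_iff by simp
qed

end
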